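(* The only regular surfaces $\mathcal{S}$ in $\mathfrak{H}$ with empty characteristic locus, closed induced 1-form $\omega_{\mathcal{S}}$ and constant horizontal mean curvature $H^h$ are (1) the planes which are perpendicular to the complex plane $\mathbb{C}=\{t=0\}$; these have $H^h\equiv 0$; and (2) the right cylinders (with rulings in the direction of $T=\partial_t$) whose profile curve is a circle of radius $R$ in $\mathbb{C}$; these have $H^h\equiv 1/R$.
   Context: The Heisenberg group $\mathfrak{H}$ is $\mathbb{R}^3$ with coordinates $(x,y,t)$ and group law $(x,y,t)*(x',y',t')=(x+x',y+y',t+t'+2(yx'-xy'))$. Left invariant vector fields: $X=\partial_x+2y\,\partial_t$, $Y=\partial_y-2x\,\partial_t$, $T=\partial_t$. Contact form: $\omega=dt+2(x\,dy-y\,dx)$. The horizontal plane at $p$ is $\mathrm{span}\{X_p,Y_p\}$, with inner product making $X,Y$ orthonormal and norm $\|\cdot\|$. A regular surface $\mathcal{S}$ in $\mathfrak{H}$ is an oriented smooth embedded regular surface of $\mathbb{R}^3$ (surface patches $\sigma(u,v)=(x(u,v),y(u,v),t(u,v))$ are smooth homeomorphisms onto their images with differential of rank 2, with orientation-preserving transition maps). Write $\partial(f,g)=f_ug_v-f_vg_u$. The horizontal normal is $N^h_\sigma=(\partial(y,t)+2y\,\partial(x,y))X+(\partial(t,x)-2x\,\partial(x,y))Y$. A point $p\in\mathcal{S}$ is characteristic if $N^h_p=0$; the set of characteristic points is the characteristic locus $\mathfrak{C}(\mathcal{S})$. At non characteristic points the unit horizontal normal is $\nu^h=N^h/\|N^h\|=\nu_1X+\nu_2Y$,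 and the horizontal mean curvature is $H^h(p)=X_p\nu_1+Y_p\nu_2$, where $\nu_1,\nu_2$ are understood as smoothly extended to a neighbourhood of $p$ in $\mathfrak{H}$ with $\nu_1^2+\nu_2^2=1$ (the value does not depend on such an extension). The sign of $H^h$ depends on the orientation of the surface. The induced 1-form is $\omega_{\mathcal{S}}=\iota^*\omega$, with $\iota:\mathcal{S}\hookrightarrow\mathfrak{H}$ the inclusion.
   Formalization: Open pieces and disjoint unions of these surfaces also qualify, so the claim is proved per connected component: each is an open piece of such a plane or cylinder, and all of it if closed in space. On a cylinder the curvature is 1/R or -1/R by orientation, and 1/R occurs. *)

theory Defs
  imports "HOL-Analysis.Analysis"
begin

section \<open>The Heisenberg group\<close>

text \<open>The Heisenberg group is carried by \<^typ>\<open>real^3\<close>; the components \<open>1, 2, 3\<close> of a point are its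
  coordinates \<open>x, y, t\<close>.  Tangent vectors are written in the standard basis, so the fields
  \<open>X = d/dx + 2y d/dt\<close> and \<open>Y = d/dy - 2x d/dt\<close> become vector-valued functions.\<close>

definition heis_X :: "real^3 \<Rightarrow> real^3" where
  "heis_X p = vector [1, 0, 2 * p$2]"

definition heis_Y :: "real^3 \<Rightarrow> real^3" where
  "heis_Y p = vector [0, 1, - 2 * p$1]"

text \<open>The contact form \<open>dt + 2 (x dy - y dx)\<close> at \<open>p\<close>, evaluated on a tangent vector \<open>v\<close>.\<close>

definition contact_form :: "real^3 \<Rightarrow> real^3 \<Rightarrow> real" where
  "contact_form p v = v$3 + 2 * (p$1 * v$2 - p$2 * v$1)"


section \<open>Oriented regular surfaces\<close>

primrec times_cont_differentiable_on ::
    "nat \<Rightarrow> 'a::real_normed_vector set \<Rightarrow> ('a \<Rightarrow> 'b::real_normed_vector) \<Rightarrow> bool" where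
  "times_cont_differentiable_on 0 S f \<longleftrightarrow> continuous_on S f"
| "times_cont_differentiable_on (Suc n) S f \<longleftrightarrow>
     (\<forall>x\<in>S. f differentiable (at x)) \<and>
     (\<forall>v. times_cont_differentiable_on n S (\<lambda>x. frechet_derivative f (at x) v))"

text \<open>Only used for open \<open>S\<close>.\<close>

definition smooth_on :: "'a::real_normed_vector set \<Rightarrow> ('a \<Rightarrow> 'b::real_normed_vector) \<Rightarrow> bool" where
  "smooth_on S f \<longleftrightarrow> (\<forall>n. times_cont_differentiable_on n S f)"

type_synonym patch = "(real^2) set \<times> (real^2 \<Rightarrow> real^3)"

definition surface_patch :: "(real^2) set \<Rightarrow> (real^2 \<Rightarrow> real^3) \<Rightarrow> bool" where
  "surface_patch U \<sigma> \<longleftrightarrow>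
     open U \<and> smooth_on U \<sigma> \<and>
     (\<exists>g. homeomorphism U (\<sigma> ` U) \<sigma> g) \<and>
     (\<forall>w\<in>U. rank (matrix (frechet_derivative \<sigma> (at w))) = 2)"

text \<open>The transition map \<open>\<sigma>'\<inverse> \<circ> \<sigma>\<close> is considered where it is defined.  For patches of one
  embedded surface its differentiability is automatic, so the only real condition is the sign of
  the Jacobian.\<close>

definition orientation_preserving_transition :: "patch \<Rightarrow> patch \<Rightarrow> bool" where
  "orientation_preserving_transition = (\<lambda>(U, \<sigma>) (U', \<sigma>').
     \<forall>w\<in>U. \<sigma> w \<in> \<sigma>' ` U' \<longrightarrow>
       (\<exists>D. (inv_into U' \<sigma>' \<circ> \<sigma> has_derivative D) (at w) \<and> det (matrix D) > 0))"

text \<open>The atlas \<open>A\<close> carries the orientation of the surface \<open>S\<close>.  That the images of the patches are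
  open in \<open>S\<close> makes \<open>S\<close> embedded.  Neither connectedness nor closedness of \<open>S\<close> is required.\<close>

definition regular_surface :: "patch set \<Rightarrow> (real^3) set \<Rightarrow> bool" where
  "regular_surface A S \<longleftrightarrow>
     (\<forall>(U, \<sigma>)\<in>A. surface_patch U \<sigma> \<and> openin (top_of_set S) (\<sigma> ` U)) \<and>
     S = (\<Union>(U, \<sigma>)\<in>A. \<sigma> ` U) \<and>
     (\<forall>P\<in>A. \<forall>Q\<in>A. orientation_preserving_transition P Q)"


section \<open>Horizontal geometry of a surface\<close>

definition partial_u :: "(real^2 \<Rightarrow> 'a::real_normed_vector) \<Rightarrow> real^2 \<Rightarrow> 'a" where
  "partial_u f w = frechet_derivative f (at w) (axis 1 1)"

definition partial_v :: "(real^2 \<Rightarrow> 'a::real_normed_vector) \<Rightarrow> real^2 \<Rightarrow> 'a" where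
  "partial_v f w = frechet_derivative f (at w) (axis 2 1)"

definition jacobian2 :: "(real^2 \<Rightarrow> real) \<Rightarrow> (real^2 \<Rightarrow> real) \<Rightarrow> real^2 \<Rightarrow> real" where
  "jacobian2 f g w = partial_u f w * partial_v g w - partial_v f w * partial_u g w"

text \<open>Horizontal vectors are represented by their two coefficients with respect to the frame
  \<open>X, Y\<close>.  Since this frame is orthonormal, the norm of a horizontal vector is the Euclidean norm
  of the coefficients, and \<^term>\<open>sgn (horizontal_normal \<sigma> w)\<close> is the unit horizontal normal at
  \<open>\<sigma> w\<close>, provided that point is not characteristic.\<close>

definition horizontal_normal :: "(real^2 \<Rightarrow> real^3) \<Rightarrow> real^2 \<Rightarrow> real^2" where
  "horizontal_normal \<sigma> w =
     (let x = (\<lambda>w. \<sigma> w $ 1); y = (\<lambda>w. \<sigma> w $ 2); t = (\<lambda>w. \<sigma> w $ 3)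
      in vector [jacobian2 y t w + 2 * y w * jacobian2 x y w,
                 jacobian2 t x w - 2 * x w * jacobian2 x y w])"

definition characteristic_locus :: "patch set \<Rightarrow> (real^3) set" where
  "characteristic_locus A = {\<sigma> w | U \<sigma> w. (U, \<sigma>) \<in> A \<and> w \<in> U \<and> horizontal_normal \<sigma> w = 0}"

text \<open>\<open>h\<close> is the horizontal mean curvature \<open>X\<^sub>p \<nu>\<^sub>1 + Y\<^sub>p \<nu>\<^sub>2\<close> at \<open>p\<close>, computed from a smooth unit
  extension \<open>\<nu>\<close> of the unit horizontal normal to a neighbourhood \<open>V\<close> of \<open>p\<close>.  Such an extension
  exists exactly at the non-characteristic points (where \<open>horizontal_normal\<close> vanishes, its \<open>sgn\<close>
  is not a unit vector), and \<open>h\<close> does not depend on its choice.\<close>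

definition has_horizontal_mean_curvature :: "patch set \<Rightarrow> real^3 \<Rightarrow> real \<Rightarrow> bool" where
  "has_horizontal_mean_curvature A p h \<longleftrightarrow>
     (\<exists>V (\<nu> :: real^3 \<Rightarrow> real^2).
        open V \<and> p \<in> V \<and> smooth_on V \<nu> \<and> (\<forall>q\<in>V. norm (\<nu> q) = 1) \<and>
        (\<forall>(U, \<sigma>)\<in>A. \<forall>w\<in>U. \<sigma> w \<in> V \<longrightarrow> \<nu> (\<sigma> w) = sgn (horizontal_normal \<sigma> w)) \<and>
        h = frechet_derivative (\<lambda>q. \<nu> q $ 1) (at p) (heis_X p)
          + frechet_derivative (\<lambda>q. \<nu> q $ 2) (at p) (heis_Y p))"

text \<open>The form induced on the surface, in the coordinates of a patch: this is \<open>\<sigma>\<^sup>*\<omega>\<close> at \<open>w\<close>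
  evaluated on \<open>a\<close>.\<close>

definition induced_form :: "(real^2 \<Rightarrow> real^3) \<Rightarrow> real^2 \<Rightarrow> real^2 \<Rightarrow> real" where
  "induced_form \<sigma> w a = contact_form (\<sigma> w) (frechet_derivative \<sigma> (at w) a)"

text \<open>The exterior derivative of a 1-form \<open>\<eta>\<close> on an open subset of the plane, evaluated on the
  constant fields \<open>a, b\<close>.\<close>

definition ext_deriv :: "(real^2 \<Rightarrow> real^2 \<Rightarrow> real) \<Rightarrow> real^2 \<Rightarrow> real^2 \<Rightarrow> real^2 \<Rightarrow> real" where
  "ext_deriv \<eta> w a b =
     frechet_derivative (\<lambda>z. \<eta> z b) (at w) a - frechet_derivative (\<lambda>z. \<eta> z a) (at w) b"

definition closed_induced_form :: "patch set \<Rightarrow> bool" where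
  "closed_induced_form A \<longleftrightarrow>
     (\<forall>(U, \<sigma>)\<in>A. \<forall>w\<in>U. \<forall>a b. ext_deriv (induced_form \<sigma>) w a b = 0)"


section \<open>Vertical planes and right circular cylinders\<close>

definition vertical_plane :: "(real^3) set \<Rightarrow> bool" where
  "vertical_plane P \<longleftrightarrow> (\<exists>n d. n \<noteq> 0 \<and> n$3 = 0 \<and> P = {p. n \<bullet> p = d})"

text \<open>The profile curve is the circle with centre \<open>z\<close> and radius \<open>R\<close> in the plane \<open>t = 0\<close>.\<close>

definition right_cylinder :: "real^2 \<Rightarrow> real \<Rightarrow> (real^3) set" where
  "right_cylinder z R = {p. vector [p$1, p$2] \<in> sphere z R}"

end

theory Submission
  imports Defs
begin

text \<open>Since \<open>d\<omega> = 4 dx \<and> dy\<close>, closedness of the induced form says that \<open>T\<close> is tangent to the surface.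
  Writing \<open>q\<close> for the projection to the \<open>(x, y)\<close>-plane, the unit horizontal normal \<open>\<nu>\<close> is then orthogonal to
  \<open>dq\<close>, and symmetry of the second derivatives of \<open>q\<close> forces \<open>\<nu>\<close> to be constant along \<open>T\<close>.  In the remaining
  tangent direction \<open>\<nu>\<close> turns at the rate \<open>H\<close>, so \<open>d\<nu> = H dq\<close>.  For constant \<open>H = c\<close> the vector
  \<open>\<nu> - c q\<close> is constant on each component: if \<open>c = 0\<close>, so is \<open>\<nu> \<bullet> q\<close>, and the component lies in a
  vertical plane; otherwise \<open>q\<close> has distance \<open>1 / \<bar>c\<bar>\<close> from a fixed point.\<close>

section \<open>Calculus of smooth functions\<close>

text \<open>The curvature comes with an unspecified extension \<open>\<nu>\<close> of the normal to
  an open set of space, so its derivative across the surface is unknown. Unit length, differentiated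
  in all directions of space, removes that derivative from the sum defining \<open>H\<close>. The
  fields X and Y differ from the coordinate directions by multiples of T, so once the derivative
  along T is known to vanish, \<open>H\<close> is an ordinary planar divergence. Local constancy
  only places a component inside a plane or a cylinder. That it is an open part of the model is a
  matter of dimension, and a closed component is the whole model because the model is connected. For
  the converse nothing is known about the atlas. The sign of the horizontal normal relative to a
  fixed unit normal of the model is locally constant, and it does not depend on the patch because
  transitions preserve orientation; on a connected model it is therefore constant. This is the
  source of the two possible curvatures of a cylinder, and only an explicit patch shows that the
  positive one occurs.\<close>

lemma has_derivative_frechet_derivative:
  "f differentiable at x \<Longrightarrow> (f has_derivative frechet_derivative f (at x)) (at x)"
  using frechet_derivative_works by blast

lemma frechet_derivativeI:
  "(f has_derivative f') (at x) \<Longrightarrow> frechet_derivative f (at x) = f'"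
  by (rule frechet_derivative_at[symmetric])

text \<open>On an open set the derivative sees only values inside the set, so agreement passes to
  derivatives of every order even though the functions may differ elsewhere.\<close>

lemma times_cont_differentiable_on_cong:
  assumes "open S" "\<And>x. x \<in> S \<Longrightarrow> f x = g x"
  shows "times_cont_differentiable_on n S f \<longleftrightarrow> times_cont_differentiable_on n S g"
proof -
  have "times_cont_differentiable_on n S g"
    if "times_cont_differentiable_on n S f" "\<And>x. x \<in> S \<Longrightarrow> f x = g x" for f g :: "'a \<Rightarrow> 'b"
    using that
  proof (induction n arbitrary: f g)
    case 0
    then show ?case by (simp cong: continuous_on_cong)
  next
    case (Suc n)
    have d: "(g has_derivative frechet_derivative f (at x)) (at x)" if "x \<in> S" for x
      using Suc.prems that assms(1)
      by (intro has_derivative_transform_within_open[OF has_derivative_frechet_derivative[of f] assms(1)]) auto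
    have "times_cont_differentiable_on n S (\<lambda>x. frechet_derivative g (at x) v)" for v
    proof (rule Suc.IH)
      show "times_cont_differentiable_on n S (\<lambda>x. frechet_derivative f (at x) v)"
        using Suc.prems(1) by simp
      show "frechet_derivative f (at x) v = frechet_derivative g (at x) v" if "x \<in> S" for x
        using frechet_derivativeI[OF d[OF that]] by simp
    qed
    with d show ?case by (auto simp: differentiable_def)
  qed
  from this[of f g, OF _ assms(2)] this[of g f, OF _ assms(2)[symmetric]] show ?thesis by blast
qed

lemma times_cont_differentiable_on_SucI:
  assumes "open S" "\<And>x. x \<in> S \<Longrightarrow> (f has_derivative f' x) (at x)"
    "\<And>v. times_cont_differentiable_on n S (\<lambda>x. f' x v)"
  shows "times_cont_differentiable_on (Suc n) S f"
proof -
  have "times_cont_differentiable_on n S (\<lambda>x. frechet_derivative f (at x) v)" for v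
    using times_cont_differentiable_on_cong[OF assms(1), of "\<lambda>x. frechet_derivative f (at x) v" "\<lambda>x. f' x v"]
      frechet_derivativeI[OF assms(2)] assms(3)[of v] by auto
  with assms(2) show ?thesis by (auto simp: differentiable_def)
qed

lemma times_cont_differentiable_on_bounded_linear:
  assumes "bounded_linear L" "open S" "times_cont_differentiable_on n S f"
  shows "times_cont_differentiable_on n S (\<lambda>x. L (f x))"
  using assms(3)
proof (induction n arbitrary: f)
  case 0
  then show ?case using assms by (simp add: bounded_linear.continuous_on)
next
  case (Suc n)
  then show ?case
    by (intro times_cont_differentiable_on_SucI[OF assms(2), where f'="\<lambda>x v. L (frechet_derivative f (at x) v)"])
      (auto intro!: bounded_linear.has_derivative[OF assms(1)] has_derivative_frechet_derivative)
qed

lemma smooth_on_bounded_linear: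
  "bounded_linear L \<Longrightarrow> open S \<Longrightarrow> smooth_on S f \<Longrightarrow> smooth_on S (\<lambda>x. L (f x))"
  by (simp add: smooth_on_def times_cont_differentiable_on_bounded_linear)

lemma smooth_on_imp_differentiable: "smooth_on S f \<Longrightarrow> x \<in> S \<Longrightarrow> f differentiable at x"
  unfolding smooth_on_def by (metis times_cont_differentiable_on.simps(2))

lemma smooth_on_frechet_derivative: "smooth_on S f \<Longrightarrow> smooth_on S (\<lambda>x. frechet_derivative f (at x) v)"
  unfolding smooth_on_def by (metis times_cont_differentiable_on.simps(2))

lemma smooth_on_imp_continuous_on: "smooth_on S f \<Longrightarrow> continuous_on S f"
  unfolding smooth_on_def by (metis times_cont_differentiable_on.simps(1))

section \<open>Symmetry of mixed second derivatives\<close>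

lemma mvt_directional:
  fixes f :: "'a::real_normed_vector \<Rightarrow> real"
  assumes "h > 0" "\<And>s. 0 \<le> s \<Longrightarrow> s \<le> h \<Longrightarrow> f differentiable at (x + s *\<^sub>R a)"
  obtains s where "0 < s" "s < h"
    "f (x + h *\<^sub>R a) - f x = h * frechet_derivative f (at (x + s *\<^sub>R a)) a"
proof -
  have "((\<lambda>s. f (x + s *\<^sub>R a)) has_real_derivative frechet_derivative f (at (x + s *\<^sub>R a)) a) (at s)"
    if "0 \<le> s" "s \<le> h" for s
  proof -
    note d = has_derivative_frechet_derivative[OF assms(2)[OF that]]
    have "((\<lambda>s. f (x + s *\<^sub>R a)) has_derivative (\<lambda>r. frechet_derivative f (at (x + s *\<^sub>R a)) (r *\<^sub>R a))) (at s)"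
      by (rule has_derivative_compose[where f="\<lambda>s. x + s *\<^sub>R a" and g=f, OF _ d]) (auto intro!: derivative_eq_intros)
    moreover have "frechet_derivative f (at (x + s *\<^sub>R a)) (r *\<^sub>R a) = r * frechet_derivative f (at (x + s *\<^sub>R a)) a" for r
      using linear_frechet_derivative[OF assms(2)[OF that]] by (simp add: linear_cmul)
    ultimately show ?thesis
      by (simp add: has_field_derivative_def mult_commute_abs)
  qed
  from MVT2[OF assms(1) this] that show ?thesis by auto
qed

text \<open>Schwarz's argument: the mean value theorem in direction \<open>a\<close>, applied to
  \<open>f (z + h b) - f z\<close>, and then in direction \<open>b\<close>, applied to the
  derivative along \<open>a\<close>. The gain is that the left-hand side of the equation is
  symmetric in \<open>a\<close> and \<open>b\<close>, while the right-hand side is not visibly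
  so.\<close>

lemma second_difference:
  fixes f :: "'a::real_normed_vector \<Rightarrow> real"
  assumes h: "h > 0"
    and f: "\<And>z. dist x z \<le> h * (norm a + norm b) \<Longrightarrow> f differentiable at z"
    and fa: "\<And>z. dist x z \<le> h * (norm a + norm b) \<Longrightarrow> (\<lambda>z. frechet_derivative f (at z) a) differentiable at z"
  obtains y where "dist x y \<le> h * (norm a + norm b)"
    "f (x + h *\<^sub>R a + h *\<^sub>R b) - f (x + h *\<^sub>R a) - f (x + h *\<^sub>R b) + f x =
       h * h * frechet_derivative (\<lambda>z. frechet_derivative f (at z) a) (at y) b"
proof -
  have in_ball: "dist x (x + s *\<^sub>R a + r *\<^sub>R b) \<le> h * (norm a + norm b)"
    if "0 \<le> s" "s \<le> h" "0 \<le> r" "r \<le> h" for s r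
  proof -
    have "norm (s *\<^sub>R a + r *\<^sub>R b) \<le> s * norm a + r * norm b"
      using norm_triangle_ineq[of "s *\<^sub>R a" "r *\<^sub>R b"] that by simp
    also have "\<dots> \<le> h * norm a + h * norm b" using that by (intro add_mono mult_right_mono) auto
    finally show ?thesis by (simp add: dist_norm algebra_simps norm_minus_commute)
  qed
  define g where "g = (\<lambda>z. f (z + h *\<^sub>R b) - f z)"
  have gd: "(g has_derivative (\<lambda>v. frechet_derivative f (at (x + s *\<^sub>R a + h *\<^sub>R b)) v - frechet_derivative f (at (x + s *\<^sub>R a)) v))
      (at (x + s *\<^sub>R a))" if "0 \<le> s" "s \<le> h" for s
    unfolding g_def
    using in_ball[OF that, of 0] in_ball[OF that, of h] h
    by (intro has_derivative_diff has_derivative_frechet_derivative f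
        has_derivative_compose[where f="\<lambda>z. z + h *\<^sub>R b" and g=f and f'="\<lambda>v. v"])
      (auto intro!: derivative_eq_intros)
  obtain s where s: "0 < s" "s < h"
    "g (x + h *\<^sub>R a) - g x = h * frechet_derivative g (at (x + s *\<^sub>R a)) a"
    using mvt_directional[OF h, of g x a] gd by (metis differentiableI)
  obtain r where r: "0 < r" "r < h"
    "frechet_derivative f (at (x + s *\<^sub>R a + h *\<^sub>R b)) a - frechet_derivative f (at (x + s *\<^sub>R a)) a
      = h * frechet_derivative (\<lambda>z. frechet_derivative f (at z) a) (at (x + s *\<^sub>R a + r *\<^sub>R b)) b"
    using mvt_directional[OF h, of "\<lambda>z. frechet_derivative f (at z) a" "x + s *\<^sub>R a" b] fa[OF in_ball] s
    by (metis less_imp_le)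
  show ?thesis
  proof (rule that)
    show "dist x (x + s *\<^sub>R a + r *\<^sub>R b) \<le> h * (norm a + norm b)"
      using in_ball s r by simp
    show "f (x + h *\<^sub>R a + h *\<^sub>R b) - f (x + h *\<^sub>R a) - f (x + h *\<^sub>R b) + f x =
       h * h * frechet_derivative (\<lambda>z. frechet_derivative f (at z) a) (at (x + s *\<^sub>R a + r *\<^sub>R b)) b"
      using s r frechet_derivativeI[OF gd[of s]] by (simp add: g_def)
  qed
qed

text \<open>Evaluating one second difference in both orders makes the two mixed derivatives agree at
  two points \<open>y\<close> and \<open>y'\<close> close to \<open>x\<close>. By continuity each is
  within \<open>e\<close> of its value at \<open>x\<close>, which is impossible if those values are
  \<open>2 * e\<close> apart.\<close>

lemma second_derivative_symmetric:
  fixes f :: "'a::real_normed_vector \<Rightarrow> real"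
  assumes "open S" "x \<in> S" "smooth_on S f"
  shows "frechet_derivative (\<lambda>z. frechet_derivative f (at z) a) (at x) b =
         frechet_derivative (\<lambda>z. frechet_derivative f (at z) b) (at x) a"
    (is "?F a b x = ?F b a x")
proof (rule ccontr)
  let ?F = "\<lambda>a b x. frechet_derivative (\<lambda>z. frechet_derivative f (at z) a) (at x) b"
  assume ne: "?F a b x \<noteq> ?F b a x"
  define e where "e = \<bar>?F a b x - ?F b a x\<bar> / 2"
  have e: "e > 0" using ne by (simp add: e_def)
  have "\<exists>d>0. \<forall>y. dist y x < d \<longrightarrow> dist (?F a b y) (?F a b x) < e" for a b
  proof -
    have "continuous (at x) (?F a b)"
      using assms smooth_on_imp_continuous_on[OF smooth_on_frechet_derivative[OF smooth_on_frechet_derivative[OF assms(3)]]]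
      by (simp add: continuous_on_eq_continuous_at)
    then show ?thesis using e unfolding continuous_at_eps_delta by auto
  qed
  then obtain d1 d2 where d: "d1 > 0" "\<And>y. dist y x < d1 \<Longrightarrow> dist (?F a b y) (?F a b x) < e"
     "d2 > 0" "\<And>y. dist y x < d2 \<Longrightarrow> dist (?F b a y) (?F b a x) < e" by metis
  obtain d3 where d3: "d3 > 0" "ball x d3 \<subseteq> S" using assms by (meson openE)
  define m where "m = min d1 (min d2 d3)"
  \<comment> \<open>The summand 1 keeps the denominator positive when \<open>a\<close> and
    \<open>b\<close> vanish, and makes the bound \<open>hm\<close> strict.\<close>
  define h where "h = m / (norm a + norm b + 1)"
  have m: "m > 0" using d d3 by (simp add: m_def)
  have h: "h > 0" using m by (simp add: h_def add_nonneg_pos)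
  have hm: "h * (norm a + norm b) < m"
    using m unfolding h_def by (simp add: add_nonneg_pos pos_divide_less_eq)
  have inS: "z \<in> S" if "dist x z \<le> h * (norm a + norm b)" for z
    using that hm d3 by (auto simp: m_def subset_iff)
  have diff: "f differentiable at z" "(\<lambda>z. frechet_derivative f (at z) v) differentiable at z" if "dist x z \<le> h * (norm a + norm b)" for z v
    using inS[OF that] assms smooth_on_imp_differentiable smooth_on_frechet_derivative by blast+
  obtain y where y: "dist x y \<le> h * (norm a + norm b)"
    "f (x + h *\<^sub>R a + h *\<^sub>R b) - f (x + h *\<^sub>R a) - f (x + h *\<^sub>R b) + f x = h * h * ?F a b y"
    using second_difference[OF h, of x a b f] diff by metis
  obtain y' where y': "dist x y' \<le> h * (norm a + norm b)"
    "f (x + h *\<^sub>R b + h *\<^sub>R a) - f (x + h *\<^sub>R b) - f (x + h *\<^sub>R a) + f x = h * h * ?F b a y'"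
    using second_difference[OF h, of x b a f] diff by (metis add.commute)
  have "h * h * ?F a b y = h * h * ?F b a y'"
    unfolding y(2)[symmetric] y'(2)[symmetric] by (simp add: ac_simps)
  then have "?F a b y = ?F b a y'" using h by simp
  moreover have "dist (?F a b y) (?F a b x) < e" "dist (?F b a y') (?F b a x) < e"
    using y(1) y'(1) hm d(2)[of y] d(4)[of y'] by (simp_all add: dist_commute m_def)
  ultimately show False
    using dist_triangle_half_r[of "?F a b y" "?F a b x" "2 * e" "?F b a x"]
    by (simp add: e_def dist_real_def)
qed

section \<open>Elementary functions are smooth\<close>

text \<open>A class of expressions closed under differentiation, so that membership alone gives
  smoothness of every order. The constructors suffice for the normalised vector field around an axis
  and for a logarithmic parametrisation of a cylinder.\<close>

inductive elementary_on :: "'a::real_normed_vector set \<Rightarrow> ('a \<Rightarrow> real) \<Rightarrow> bool" for S where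
  const: "elementary_on S (\<lambda>x. c)"
| linear: "bounded_linear f \<Longrightarrow> elementary_on S f"
| add: "elementary_on S f \<Longrightarrow> elementary_on S g \<Longrightarrow> elementary_on S (\<lambda>x. f x + g x)"
| mult: "elementary_on S f \<Longrightarrow> elementary_on S g \<Longrightarrow> elementary_on S (\<lambda>x. f x * g x)"
| inverse: "elementary_on S f \<Longrightarrow> (\<forall>x\<in>S. f x \<noteq> 0) \<Longrightarrow> elementary_on S (\<lambda>x. inverse (f x))"
| sqrt: "elementary_on S f \<Longrightarrow> (\<forall>x\<in>S. f x > 0) \<Longrightarrow> elementary_on S (\<lambda>x. sqrt (f x))"
| ln: "elementary_on S f \<Longrightarrow> (\<forall>x\<in>S. f x > 0) \<Longrightarrow> elementary_on S (\<lambda>x. ln (f x))"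

text \<open>A single \<open>f'\<close> serves all points, and for each fixed direction it is again
  elementary as a function of the point; this is what an induction on the order of differentiability
  consumes.\<close>

lemma elementary_on_has_derivative:
  assumes "elementary_on S f"
  shows "\<exists>f'. (\<forall>x\<in>S. (f has_derivative f' x) (at x)) \<and> (\<forall>v. elementary_on S (\<lambda>x. f' x v))"
  using assms
proof induction
  case (const c)
  show ?case
    by (rule exI[of _ "\<lambda>x v. 0"]) (auto intro: elementary_on.intros)
next
  case (linear f)
  then show ?case
    by (intro exI[of _ "\<lambda>x v. f v"]) (auto intro: elementary_on.intros bounded_linear_imp_has_derivative)
next
  case (add f g)
  then obtain f' g' where "\<forall>x\<in>S. (f has_derivative f' x) (at x)" "\<forall>v. elementary_on S (\<lambda>x. f' x v)"
    "\<forall>x\<in>S. (g has_derivative g' x) (at x)" "\<forall>v. elementary_on S (\<lambda>x. g' x v)" by blast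
  then show ?case
    by (intro exI[of _ "\<lambda>x v. f' x v + g' x v"]) (auto intro: elementary_on.intros has_derivative_add)
next
  case (mult f g)
  then obtain f' g' where "\<forall>x\<in>S. (f has_derivative f' x) (at x)" "\<forall>v. elementary_on S (\<lambda>x. f' x v)"
    "\<forall>x\<in>S. (g has_derivative g' x) (at x)" "\<forall>v. elementary_on S (\<lambda>x. g' x v)" by blast
  then show ?case using mult
    by (intro exI[of _ "\<lambda>x v. f x * g' x v + f' x v * g x"])
      (auto intro!: elementary_on.add elementary_on.mult has_derivative_mult)
next
  case (inverse f)
  then obtain f' where f': "\<forall>x\<in>S. (f has_derivative f' x) (at x)" "\<forall>v. elementary_on S (\<lambda>x. f' x v)" by blast
  \<comment> \<open>The class has neither negation nor division, so derivatives are spelled with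
    constant factors such as \<open>-1\<close> and \<open>1/2\<close> and with
    \<open>inverse\<close>.\<close>
  show ?case
  proof (intro exI[of _ "\<lambda>x v. (-1) * (inverse (f x) * f' x v * inverse (f x))"] conjI ballI allI)
    fix x assume "x \<in> S"
    then show "((\<lambda>x. inverse (f x)) has_derivative (\<lambda>v. (-1) * (inverse (f x) * f' x v * inverse (f x)))) (at x)"
      using f' inverse Deriv.has_derivative_inverse[where f=f and x=x and f'="f' x" and S=UNIV] by auto
  next
    show "elementary_on S (\<lambda>x. (-1) * (inverse (f x) * f' x v * inverse (f x)))" for v
      using f' inverse by (intro elementary_on.mult elementary_on.const elementary_on.inverse) auto
  qed
next
  case (sqrt f)
  then obtain f' where f': "\<forall>x\<in>S. (f has_derivative f' x) (at x)" "\<forall>v. elementary_on S (\<lambda>x. f' x v)" by blast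
  show ?case
  proof (intro exI[of _ "\<lambda>x v. f' x v * (inverse (sqrt (f x)) * (1/2))"] conjI ballI allI)
    fix x assume "x \<in> S"
    then show "((\<lambda>x. sqrt (f x)) has_derivative (\<lambda>v. f' x v * (inverse (sqrt (f x)) * (1/2)))) (at x)"
      using f' sqrt has_derivative_real_sqrt[where g=f and x=x and g'="f' x" and s=UNIV] by (auto simp: field_simps)
  next
    show "elementary_on S (\<lambda>x. f' x v * (inverse (sqrt (f x)) * (1/2)))" for v
      using f' sqrt by (intro elementary_on.mult elementary_on.const elementary_on.inverse elementary_on.sqrt) auto
  qed
next
  case (ln f)
  then obtain f' where f': "\<forall>x\<in>S. (f has_derivative f' x) (at x)" "\<forall>v. elementary_on S (\<lambda>x. f' x v)" by blast
  show ?case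
  proof (intro exI[of _ "\<lambda>x v. f' x v * inverse (f x)"] conjI ballI allI)
    fix x assume "x \<in> S"
    then show "((\<lambda>x. ln (f x)) has_derivative (\<lambda>v. f' x v * inverse (f x))) (at x)"
      using f' ln DERIV_ln[THEN DERIV_compose_FDERIV, of f x "f' x" UNIV] by (auto simp: field_simps)
  next
    show "elementary_on S (\<lambda>x. f' x v * inverse (f x))" for v
      using f' ln by (intro elementary_on.mult elementary_on.inverse) auto
  qed
qed

lemma elementary_on_imp_smooth_on:
  assumes "open S" "elementary_on S f"
  shows "smooth_on S f"
  unfolding smooth_on_def
proof
  show "times_cont_differentiable_on n S f" for n
    using assms(2)
  proof (induction n arbitrary: f)
    case 0
    then show ?case
      using elementary_on_has_derivative[OF 0]
      by (auto intro!: continuous_at_imp_continuous_on intro: has_derivative_continuous)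
  next
    case (Suc n)
    from elementary_on_has_derivative[OF Suc.prems] obtain f' where
      "\<forall>x\<in>S. (f has_derivative f' x) (at x)" "\<forall>v. elementary_on S (\<lambda>x. f' x v)" by blast
    with Suc.IH show ?case
      by (intro times_cont_differentiable_on_SucI[OF assms(1), of f f']) auto
  qed
qed

section \<open>Vector-valued maps and their components\<close>

lemma frechet_derivative_vec_nth:
  fixes f :: "'a::real_normed_vector \<Rightarrow> real^'n"
  assumes "f differentiable at x"
  shows "((\<lambda>x. f x $ i) has_derivative (\<lambda>v. frechet_derivative f (at x) v $ i)) (at x)"
    and "frechet_derivative (\<lambda>x. f x $ i) (at x) = (\<lambda>v. frechet_derivative f (at x) v $ i)"
proof -
  show "((\<lambda>x. f x $ i) has_derivative (\<lambda>v. frechet_derivative f (at x) v $ i)) (at x)"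
    by (rule bounded_linear.has_derivative[OF bounded_linear_vec_nth has_derivative_frechet_derivative[OF assms]])
  then show "frechet_derivative (\<lambda>x. f x $ i) (at x) = (\<lambda>v. frechet_derivative f (at x) v $ i)"
    by (rule frechet_derivativeI)
qed

lemma differentiable_vec:
  fixes f :: "'a::real_normed_vector \<Rightarrow> real^'n"
  assumes "\<And>i. (\<lambda>x. f x $ i) differentiable at x"
  shows "f differentiable at x"
  using assms differentiable_componentwise_within[of f x UNIV]
  by (auto simp: Basis_vec_def inner_axis)

lemma smooth_on_vec:
  fixes f :: "'a::real_normed_vector \<Rightarrow> real^'n"
  assumes "open S" "\<And>i. smooth_on S (\<lambda>x. f x $ i)"
  shows "smooth_on S f"
  unfolding smooth_on_def
proof
  show "times_cont_differentiable_on n S f" for n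
    using assms(2)
  proof (induction n arbitrary: f)
    case 0
    have "continuous_on S (\<lambda>x. \<chi> i. f x $ i)"
      using 0 by (intro continuous_on_vec_lambda) (simp add: smooth_on_imp_continuous_on)
    then show ?case by simp
  next
    case (Suc n)
    have d: "f differentiable at x" if "x \<in> S" for x
      using Suc.prems that by (intro differentiable_vec) (rule smooth_on_imp_differentiable)
    have "smooth_on S (\<lambda>x. frechet_derivative f (at x) v $ i)" for v i
    proof -
      have "smooth_on S (\<lambda>x. frechet_derivative (\<lambda>x. f x $ i) (at x) v)"
        by (rule smooth_on_frechet_derivative[OF Suc.prems])
      then show ?thesis
        unfolding smooth_on_def
        using times_cont_differentiable_on_cong[OF assms(1),
            of "\<lambda>x. frechet_derivative (\<lambda>x. f x $ i) (at x) v" "\<lambda>x. frechet_derivative f (at x) v $ i"]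
          frechet_derivative_vec_nth(2)[OF d] by simp
    qed
    with d show ?case using Suc.IH by auto
  qed
qed

lemma smooth_on_const: "smooth_on S (\<lambda>x. c)"
proof -
  have "times_cont_differentiable_on n S (\<lambda>x. c)" for n and c :: 'b
    by (induction n arbitrary: c) auto
  then show ?thesis by (simp add: smooth_on_def)
qed

section \<open>Surfaces with closed induced form\<close>

lemma second_derivative_symmetric_vec:
  fixes f :: "'a::real_normed_vector \<Rightarrow> real^'n"
  assumes "open S" "x \<in> S" "smooth_on S f"
  shows "frechet_derivative (\<lambda>z. frechet_derivative f (at z) a) (at x) b =
         frechet_derivative (\<lambda>z. frechet_derivative f (at z) b) (at x) a"
proof (rule vec_eq_iff[THEN iffD2], rule allI)
  fix i
  have *: "frechet_derivative (\<lambda>z. frechet_derivative f (at z) a) (at x) b $ i =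
      frechet_derivative (\<lambda>z. frechet_derivative (\<lambda>x. f x $ i) (at z) a) (at x) b" for a b
  proof -
    have "(\<lambda>z. frechet_derivative f (at z) a) differentiable at x"
      using assms smooth_on_imp_differentiable smooth_on_frechet_derivative by blast
    note d = frechet_derivative_vec_nth(1)[OF this, of i]
    have "((\<lambda>z. frechet_derivative (\<lambda>x. f x $ i) (at z) a) has_derivative
        (\<lambda>v. frechet_derivative (\<lambda>z. frechet_derivative f (at z) a) (at x) v $ i)) (at x)"
      by (rule has_derivative_transform_within_open[OF d assms(1,2)])
        (simp add: frechet_derivative_vec_nth(2) smooth_on_imp_differentiable[OF assms(3)])
    from frechet_derivativeI[OF this] show ?thesis by simp
  qed
  show "frechet_derivative (\<lambda>z. frechet_derivative f (at z) a) (at x) b $ i =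
         frechet_derivative (\<lambda>z. frechet_derivative f (at z) b) (at x) a $ i"
    unfolding * by (rule second_derivative_symmetric[OF assms(1,2)])
      (rule smooth_on_bounded_linear[OF bounded_linear_vec_nth assms(1,3)])
qed

section \<open>Coordinates in dimensions 2 and 3\<close>

definition proj_xy :: "real^3 \<Rightarrow> real^2" where
  "proj_xy p = vector [p$1, p$2]"

lemma proj_xy_nth [simp]: "proj_xy p $ 1 = p $ 1" "proj_xy p $ 2 = p $ 2"
  by (simp_all add: proj_xy_def)

lemma inner_real2: "(a::real^2) \<bullet> b = a$1 * b$1 + a$2 * b$2"
  by (simp add: inner_vec_def sum_2)

lemma inner_real3: "(a::real^3) \<bullet> b = a$1 * b$1 + a$2 * b$2 + a$3 * b$3"
  by (simp add: inner_vec_def sum_3)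

lemma eq_real2_iff: "(a::real^2) = b \<longleftrightarrow> a$1 = b$1 \<and> a$2 = b$2"
  by (simp add: vec_eq_iff forall_2)

lemma eq_real3_iff: "(a::real^3) = b \<longleftrightarrow> a$1 = b$1 \<and> a$2 = b$2 \<and> a$3 = b$3"
  by (simp add: vec_eq_iff forall_3)

lemma bounded_linear_proj_xy: "bounded_linear proj_xy"
  unfolding linear_conv_bounded_linear[symmetric]
  by (rule linearI) (simp_all add: eq_real2_iff)

lemma axis_real2 [simp]: "axis (1::2) (1::real) $ 1 = 1" "axis (1::2) (1::real) $ 2 = 0"
  "axis (2::2) (1::real) $ 1 = 0" "axis (2::2) (1::real) $ 2 = 1"
  by (simp_all add: axis_def)

lemma axis_real3 [simp]: "axis (1::3) (1::real) $ 1 = 1" "axis (1::3) (1::real) $ 2 = 0" "axis (1::3) (1::real) $ 3 = 0"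
  "axis (2::3) (1::real) $ 1 = 0" "axis (2::3) (1::real) $ 2 = 1" "axis (2::3) (1::real) $ 3 = 0"
  "axis (3::3) (1::real) $ 1 = 0" "axis (3::3) (1::real) $ 2 = 0" "axis (3::3) (1::real) $ 3 = 1"
  by (simp_all add: axis_def)

lemma linear_real2_expand:
  assumes "linear L"
  shows "L (a::real^2) = a$1 *\<^sub>R L (axis 1 1) + a$2 *\<^sub>R L (axis 2 1)"
proof -
  have "a = a$1 *\<^sub>R axis 1 1 + a$2 *\<^sub>R axis 2 1" by (simp add: eq_real2_iff)
  from arg_cong[OF this, of L] show ?thesis by (simp only: linear_add[OF assms] linear_scale[OF assms])
qed

lemma linear_real3_expand:
  assumes "linear L"
  shows "L (a::real^3) = a$1 *\<^sub>R L (axis 1 1) + a$2 *\<^sub>R L (axis 2 1) + a$3 *\<^sub>R L (axis 3 1)"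
proof -
  have "a = a$1 *\<^sub>R axis 1 1 + a$2 *\<^sub>R axis 2 1 + a$3 *\<^sub>R axis 3 1" by (simp add: eq_real3_iff)
  from arg_cong[OF this, of L] show ?thesis by (simp only: linear_add[OF assms] linear_scale[OF assms])
qed

section \<open>Patches, their normals and the pulled-back contact form\<close>

lemma surface_patchD:
  assumes "surface_patch U \<sigma>"
  shows "open U" "smooth_on U \<sigma>" "inj_on \<sigma> U" "continuous_on U \<sigma>"
    and "\<And>w. w \<in> U \<Longrightarrow> \<sigma> differentiable at w"
    and "\<And>w. w \<in> U \<Longrightarrow> linear (frechet_derivative \<sigma> (at w))"
    and "\<And>w. w \<in> U \<Longrightarrow> inj (frechet_derivative \<sigma> (at w))"
proof -
  show o: "open U" and s: "smooth_on U \<sigma>" using assms by (auto simp: surface_patch_def)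
  show "inj_on \<sigma> U" "continuous_on U \<sigma>"
    using assms by (auto simp: surface_patch_def homeomorphism_def inj_on_def) metis
  show d: "\<sigma> differentiable at w" if "w \<in> U" for w
    using s that by (rule smooth_on_imp_differentiable)
  show l: "linear (frechet_derivative \<sigma> (at w))" if "w \<in> U" for w
    by (rule linear_frechet_derivative[OF d[OF that]])
  show "inj (frechet_derivative \<sigma> (at w))" if "w \<in> U" for w
  proof -
    \<comment> \<open>Rank equal to the number of columns means injectivity, the form in which
      regularity of a patch is used from here on.\<close>
    have "rank (matrix (frechet_derivative \<sigma> (at w))) = CARD(2)"
      using assms that by (simp add: surface_patch_def)
    then have "inj ((*v) (matrix (frechet_derivative \<sigma> (at w))))"
      by (simp only: full_rank_injective)
    moreover have "(*v) (matrix (frechet_derivative \<sigma> (at w))) = frechet_derivative \<sigma> (at w)"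
      using matrix_works[OF l[OF that, unfolded linear_matrix_vector_mul_eq[symmetric]]] by (simp add: fun_eq_iff)
    ultimately show ?thesis by simp
  qed
qed

lemma horizontal_normal_nth:
  assumes "\<sigma> differentiable at w"
  defines "u \<equiv> frechet_derivative \<sigma> (at w) (axis 1 1)"
    and "v \<equiv> frechet_derivative \<sigma> (at w) (axis 2 1)"
  shows "horizontal_normal \<sigma> w $ 1 = u$2 * v$3 - v$2 * u$3 + 2 * \<sigma> w $ 2 * (u$1 * v$2 - v$1 * u$2)"
    and "horizontal_normal \<sigma> w $ 2 = u$3 * v$1 - v$3 * u$1 - 2 * \<sigma> w $ 1 * (u$1 * v$2 - v$1 * u$2)"
  using assms(1)
  by (simp_all add: horizontal_normal_def jacobian2_def partial_u_def partial_v_def u_def v_def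
      frechet_derivative_vec_nth(2) Let_def)

text \<open>This is the pullback of \<open>4 dx \<and> dy\<close>. The terms with second derivatives
  of \<sigma> cancel by symmetry; what survives comes from the product rule applied to
  \<open>2 (x dy - y dx)\<close>.\<close>

lemma ext_deriv_induced_form:
  assumes "surface_patch U \<sigma>" "w \<in> U"
  defines "D \<equiv> frechet_derivative \<sigma> (at w)"
  shows "ext_deriv (induced_form \<sigma>) w a b = 4 * (D a $ 1 * D b $ 2 - D b $ 1 * D a $ 2)"
proof -
  note p = surface_patchD[OF assms(1)]
  define E where "E = (\<lambda>b. frechet_derivative (\<lambda>z. frechet_derivative \<sigma> (at z) b) (at w))"
  have sym: "E a b = E b a" unfolding E_def
    by (rule second_derivative_symmetric_vec[OF p(1) assms(2) p(2)])
  have E: "((\<lambda>z. frechet_derivative \<sigma> (at z) b $ i) has_derivative (\<lambda>h. E b h $ i)) (at w)" for b i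
    unfolding E_def
    by (rule frechet_derivative_vec_nth(1))
      (use p(2) assms(2) smooth_on_imp_differentiable smooth_on_frechet_derivative in blast)
  have D: "((\<lambda>z. \<sigma> z $ i) has_derivative (\<lambda>h. D h $ i)) (at w)" for i
    unfolding D_def by (rule frechet_derivative_vec_nth(1)[OF p(5)[OF assms(2)]])
  have "((\<lambda>z. induced_form \<sigma> z b) has_derivative
      (\<lambda>h. E b h $ 3 + 2 * ((\<sigma> w $ 1 * E b h $ 2 + D h $ 1 * D b $ 2)
         - (\<sigma> w $ 2 * E b h $ 1 + D h $ 2 * D b $ 1)))) (at w)" for b
    unfolding induced_form_def contact_form_def D_def[symmetric]
    by (intro has_derivative_add has_derivative_mult_right has_derivative_diff
        has_derivative_mult[OF D E, folded D_def] E)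
  note * = frechet_derivativeI[OF this]
  show ?thesis unfolding ext_deriv_def * sym by simp
qed

section \<open>How the unit normal turns along the surface\<close>

lemma real2_orthogonal_unit:
  assumes "n1^2 + n2^2 = (1::real)" "n1 * a1 + n2 * a2 = 0"
  shows "a1 = - n2 * (n1 * a2 - n2 * a1)" "a2 = n1 * (n1 * a2 - n2 * a1)"
proof -
  have "- n2 * (n1 * a2 - n2 * a1) = (n1^2 + n2^2) * a1 - n1 * (n1 * a1 + n2 * a2)"
    "n1 * (n1 * a2 - n2 * a1) = (n1^2 + n2^2) * a2 - n2 * (n1 * a1 + n2 * a2)"
    by (simp_all add: algebra_simps power2_eq_square)
  with assms show "a1 = - n2 * (n1 * a2 - n2 * a1)" "a2 = n1 * (n1 * a2 - n2 * a1)" by simp_all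
qed

text \<open>Write \<open>J n = (- n$2, n$1)\<close> for the normal turned by a right angle. A vector
  of the plane orthogonal to \<open>n\<close> is a multiple of \<open>J n\<close>, so
  \<open>D a\<close> consists of \<open>s a\<close> times \<open>J n\<close> and a vertical
  component. Hence \<open>s\<close> and the vertical component are coordinates on the tangent plane,
  and their determinant cannot vanish because \<open>D\<close> is injective.\<close>

lemma tangent_plane_coordinates:
  fixes D :: "real^2 \<Rightarrow> real^3" and n :: "real^2"
  assumes D: "linear D" "inj D" and unit: "norm n = 1" and nD: "\<And>a. n \<bullet> proj_xy (D a) = 0"
  defines "s \<equiv> \<lambda>a. n$1 * D a $ 2 - n$2 * D a $ 1"
  shows "D a $ 1 = - n$2 * s a" "D a $ 2 = n$1 * s a"
    and "s (axis 1 1) * D (axis 2 1) $ 3 \<noteq> s (axis 2 1) * D (axis 1 1) $ 3"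
proof -
  have one: "(n$1)^2 + (n$2)^2 = 1"
    using unit by (simp add: norm_eq_1 inner_real2 power2_eq_square)
  have Ds: "D a $ 1 = - n$2 * s a" "D a $ 2 = n$1 * s a" for a
    using real2_orthogonal_unit[OF one, of "D a $ 1" "D a $ 2"] nD[of a] by (simp_all add: s_def inner_real2)
  show "D a $ 1 = - n$2 * s a" "D a $ 2 = n$1 * s a" by (fact Ds)+
  define t where "t = (\<lambda>a. D a $ 3)"
  define e1 e2 :: "real^2" where "e1 = axis 1 1" and "e2 = axis 2 1"
  have ab: "e1$1 = 1" "e1$2 = 0" "e2$1 = 0" "e2$2 = 1" by (simp_all add: e1_def e2_def)
  have "s e1 * t e2 \<noteq> s e2 * t e1"
  proof
    assume 0: "s e1 * t e2 = s e2 * t e1"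
    \<comment> \<open>A zero determinant puts this combination into the kernel of \<open>D\<close>,
      so both values of \<open>s\<close> vanish. Then the same combination formed with
      \<open>t\<close> lies in the kernel too, and finally so does \<open>e1\<close> itself.\<close>
    have "D (s e2 *\<^sub>R e1 - s e1 *\<^sub>R e2) = 0"
      using 0 by (simp add: mult.commute eq_real3_iff linear_diff[OF D(1)] linear_scale[OF D(1)] Ds t_def)
    then have "s e2 *\<^sub>R e1 - s e1 *\<^sub>R e2 = 0"
      using D linear_injective_0 by blast
    then have "s e2 = 0" "s e1 = 0" by (simp_all add: eq_real2_iff ab)
    then have "D (t e2 *\<^sub>R e1 - t e1 *\<^sub>R e2) = 0"
      by (simp add: eq_real3_iff linear_diff[OF D(1)] linear_scale[OF D(1)] Ds t_def)
    then have "t e2 *\<^sub>R e1 - t e1 *\<^sub>R e2 = 0"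
      using D linear_injective_0 by blast
    then have "t e1 = 0" by (simp add: eq_real2_iff ab)
    with \<open>s e1 = 0\<close> have "D e1 = 0" by (simp add: eq_real3_iff Ds t_def)
    then have "e1 = 0" using D linear_injective_0 by blast
    then show False using ab by simp
  qed
  then show "s (axis 1 1) * D (axis 2 1) $ 3 \<noteq> s (axis 2 1) * D (axis 1 1) $ 3"
    by (simp add: t_def e1_def e2_def)
qed

text \<open>The pointwise core, with \<open>L\<close> and \<open>D\<close> standing for the
  derivatives of the extended normal and of the patch. Both \<open>L h\<close> and the projection of
  \<open>D a\<close> are multiples of \<open>J n = (- n$2, n$1)\<close>, with coefficients
  \<open>k h\<close> and \<open>s a\<close>. Thus \<open>sym\<close> says that \<open>k\<close> on
  the tangent plane is proportional to \<open>s\<close>. Since \<open>k (D a)\<close> is a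
  combination of \<open>s a\<close> and the vertical component of \<open>D a\<close>, and these are
  independent, the vertical coefficient of \<open>k\<close> is 0. The point \<open>p\<close> is
  arbitrary: it enters the two fields only through vertical terms, which no longer count.\<close>

lemma derivative_unit_normal_eq:
  fixes L :: "real^3 \<Rightarrow> real^2" and D :: "real^2 \<Rightarrow> real^3" and n :: "real^2" and p :: "real^3"
  assumes L: "linear L" and D: "linear D" "inj D"
    and unit: "norm n = 1" and nL: "\<And>h. n \<bullet> L h = 0" and nD: "\<And>a. n \<bullet> proj_xy (D a) = 0"
    and sym: "\<And>a b. L (D b) \<bullet> proj_xy (D a) = L (D a) \<bullet> proj_xy (D b)"
  shows "L (D a) = (L (heis_X p) $ 1 + L (heis_Y p) $ 2) *\<^sub>R proj_xy (D a)"
proof -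
  define k where "k = (\<lambda>h. n$1 * L h $ 2 - n$2 * L h $ 1)"
  define s where "s = (\<lambda>a. n$1 * D a $ 2 - n$2 * D a $ 1)"
  have one: "(n$1)^2 + (n$2)^2 = 1"
    using unit by (simp add: norm_eq_1 inner_real2 power2_eq_square)
  have Lk: "L h $ 1 = - n$2 * k h" "L h $ 2 = n$1 * k h" for h
    using real2_orthogonal_unit[OF one, of "L h $ 1" "L h $ 2"] nL[of h] by (simp_all add: k_def inner_real2)
  have s: "n$1 * D a $ 2 - n$2 * D a $ 1 = s a" for a by (simp add: s_def)
  note Ds = tangent_plane_coordinates(1,2)[OF D unit nD, unfolded s]
  have k: "k h = h$1 * k (axis 1 1) + h$2 * k (axis 2 1) + h$3 * k (axis 3 1)" for h
    unfolding k_def by (subst (1 2) linear_real3_expand[OF L]) (simp add: algebra_simps)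
  \<comment> \<open>This is \<open>k\<close> at the horizontal vector \<open>J n\<close>, the rate
    at which \<open>n\<close> turns along the surface, and equally the planar divergence of the
    extended normal; the contribution along \<open>n\<close> is missing because \<open>L\<close>
    takes values orthogonal to \<open>n\<close>.\<close>
  define c where "c = n$1 * k (axis 2 1) - n$2 * k (axis 1 1)"
  have kD: "k (D a) = s a * c + D a $ 3 * k (axis 3 1)" for a
    by (subst k) (simp add: Ds c_def algebra_simps)
  have "k (D b) * s a * ((n$1)^2 + (n$2)^2) = k (D a) * s b * ((n$1)^2 + (n$2)^2)" for a b
    using sym[of b a] by (simp add: inner_real2 Lk Ds algebra_simps power2_eq_square)
  then have ks: "k (D b) * s a = k (D a) * s b" for a b
    by (simp add: one)
  \<comment> \<open>The parts of \<open>ks\<close> containing \<open>c\<close> are symmetric and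
    cancel, which leaves the determinant of \<open>tangent_plane_coordinates\<close>.\<close>
  have "k (axis 3 1) * (s a * D b $ 3 - s b * D a $ 3) = 0" for a b
    using ks[of b a] by (simp add: kD algebra_simps)
  then have k3: "k (axis 3 1) = 0"
    using tangent_plane_coordinates(3)[OF D unit nD, unfolded s] by force
  have "L (heis_X p) $ 1 + L (heis_Y p) $ 2 = c"
    unfolding Lk k[of "heis_X p"] k[of "heis_Y p"] by (simp add: heis_X_def heis_Y_def k3 c_def algebra_simps)
  then show ?thesis
    by (simp add: eq_real2_iff Lk Ds kD k3)
qed

text \<open>By closedness the projections of the two tangent vectors \<open>u\<close> and
  \<open>v\<close> are parallel. This removes the terms with \<open>jacobian2 x y\<close> from the
  normal, and the remaining inner product is again a multiple of the same vanishing
  determinant.\<close>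

lemma horizontal_normal_orthogonal:
  assumes "surface_patch U \<sigma>" "w \<in> U" "\<And>a b. ext_deriv (induced_form \<sigma>) w a b = 0"
  shows "sgn (horizontal_normal \<sigma> w) \<bullet> proj_xy (frechet_derivative \<sigma> (at w) a) = 0"
proof -
  note p = surface_patchD[OF assms(1)]
  let ?D = "frechet_derivative \<sigma> (at w)"
  define u where "u = ?D (axis 1 1)" define v where "v = ?D (axis 2 1)"
  have uv: "u$1 * v$2 = v$1 * u$2"
    using assms(3)[of "axis 1 1" "axis 2 1"] unfolding ext_deriv_induced_form[OF assms(1,2)]
    by (simp add: u_def v_def)
  note N = horizontal_normal_nth[OF p(5)[OF assms(2)], folded u_def v_def]
  have "?D a = a$1 *\<^sub>R u + a$2 *\<^sub>R v"
    unfolding u_def v_def by (rule linear_real2_expand[OF p(6)[OF assms(2)]])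
  then have "horizontal_normal \<sigma> w \<bullet> proj_xy (?D a) = (a$1 * u$3 + a$2 * v$3) * (v$1 * u$2 - u$1 * v$2)"
    by (simp add: inner_real2 N uv) (simp add: algebra_simps uv)
  then show ?thesis by (simp add: sgn_div_norm uv)
qed

text \<open>The hypotheses of \<open>derivative_unit_normal_eq\<close> come from differentiating two
  identities: \<open>\<nu> \<bullet> \<nu> = 1\<close> in space, and the orthogonality of
  \<open>\<nu>\<close> to the projected tangent vectors along the patch.\<close>

lemma unit_normal_minus_position_has_derivative_0:
  assumes A: "(U, \<sigma>) \<in> A" and p: "surface_patch U \<sigma>" and w: "w \<in> U"
    and closed: "closed_induced_form A"
    and H: "has_horizontal_mean_curvature A (\<sigma> w) c"
  shows "((\<lambda>z. sgn (horizontal_normal \<sigma> z) - c *\<^sub>R proj_xy (\<sigma> z)) has_derivative (\<lambda>h. 0)) (at w)"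
proof -
  note q = surface_patchD[OF p]
  have orth: "sgn (horizontal_normal \<sigma> z) \<bullet> proj_xy (frechet_derivative \<sigma> (at z) a) = 0" if "z \<in> U" for z a
    using closed A that by (intro horizontal_normal_orthogonal[OF p]) (auto simp: closed_induced_form_def)
  from H obtain V and \<nu> :: "real^3 \<Rightarrow> real^2" where V: "open V" "\<sigma> w \<in> V" "smooth_on V \<nu>"
      "\<And>q. q \<in> V \<Longrightarrow> norm (\<nu> q) = 1"
      "\<And>z. z \<in> U \<Longrightarrow> \<sigma> z \<in> V \<Longrightarrow> \<nu> (\<sigma> z) = sgn (horizontal_normal \<sigma> z)"
      "c = frechet_derivative (\<lambda>q. \<nu> q $ 1) (at (\<sigma> w)) (heis_X (\<sigma> w))
         + frechet_derivative (\<lambda>q. \<nu> q $ 2) (at (\<sigma> w)) (heis_Y (\<sigma> w))"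
    using A unfolding has_horizontal_mean_curvature_def by blast
  define L where "L = frechet_derivative \<nu> (at (\<sigma> w))"
  define D where "D = frechet_derivative \<sigma> (at w)"
  have d\<nu>: "\<nu> differentiable at (\<sigma> w)" by (rule smooth_on_imp_differentiable[OF V(3,2)])
  have L: "(\<nu> has_derivative L) (at (\<sigma> w))" unfolding L_def
    by (rule has_derivative_frechet_derivative[OF d\<nu>])
  have D: "(\<sigma> has_derivative D) (at w)" unfolding D_def
    by (rule has_derivative_frechet_derivative[OF q(5)[OF w]])
  have c: "c = L (heis_X (\<sigma> w)) $ 1 + L (heis_Y (\<sigma> w)) $ 2"
    using V(6) by (simp add: frechet_derivative_vec_nth(2)[OF d\<nu>] L_def)
  \<comment> \<open>The parameters near \<open>w\<close> at which \<open>\<nu>\<close> composed with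
    \<sigma> is known to be the unit horizontal normal.\<close>
  define W where "W = U \<inter> \<sigma> -` V"
  have W: "open W" "w \<in> W"
    using w V by (auto simp: W_def intro: continuous_open_preimage[OF q(4,1)])
  have G: "((\<lambda>z. \<nu> (\<sigma> z)) has_derivative (\<lambda>h. L (D h))) (at w)"
    by (rule has_derivative_compose[OF D L])
  have nL: "\<nu> (\<sigma> w) \<bullet> L h = 0" for h
  proof -
    have "((\<lambda>q. \<nu> q \<bullet> \<nu> q) has_derivative (\<lambda>h. \<nu> (\<sigma> w) \<bullet> L h + L h \<bullet> \<nu> (\<sigma> w))) (at (\<sigma> w))"
      by (rule has_derivative_inner[OF L L])
    moreover have "((\<lambda>q. \<nu> q \<bullet> \<nu> q) has_derivative (\<lambda>h. 0)) (at (\<sigma> w))"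
      by (rule has_derivative_transform_within_open[OF has_derivative_const[of 1] V(1,2)])
        (use V(4) in \<open>simp add: norm_eq_1\<close>)
    ultimately have "\<nu> (\<sigma> w) \<bullet> L h + L h \<bullet> \<nu> (\<sigma> w) = 0" by (rule has_derivative_unique[THEN fun_cong])
    then show ?thesis by (simp add: inner_commute)
  qed
  define E where "E = (\<lambda>b. frechet_derivative (\<lambda>z. frechet_derivative \<sigma> (at z) b) (at w))"
  \<comment> \<open>Differentiating \<open>\<nu> \<bullet> dq a = 0\<close> in direction
    \<open>b\<close> turns the left-hand side into an expression in the second derivatives of
    \<sigma>, which is symmetric in \<open>a\<close> and \<open>b\<close>.\<close>
  have LE: "L (D b) \<bullet> proj_xy (D a) = - (\<nu> (\<sigma> w) \<bullet> proj_xy (E a b))" for a b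
  proof -
    have "((\<lambda>z. frechet_derivative \<sigma> (at z) a) has_derivative E a) (at w)"
      unfolding E_def using q(2) w smooth_on_imp_differentiable smooth_on_frechet_derivative
      by (blast intro: has_derivative_frechet_derivative)
    note E = bounded_linear.has_derivative[OF bounded_linear_proj_xy this]
    have "((\<lambda>z. \<nu> (\<sigma> z) \<bullet> proj_xy (frechet_derivative \<sigma> (at z) a)) has_derivative
       (\<lambda>h. \<nu> (\<sigma> w) \<bullet> proj_xy (E a h) + L (D h) \<bullet> proj_xy (D a))) (at w)"
      using has_derivative_inner[OF G E] by (simp add: D_def)
    moreover have "((\<lambda>z. \<nu> (\<sigma> z) \<bullet> proj_xy (frechet_derivative \<sigma> (at z) a)) has_derivative (\<lambda>h. 0)) (at w)"
      by (rule has_derivative_transform_within_open[OF has_derivative_const[of 0] W])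
        (use V(5) orth in \<open>simp add: W_def\<close>)
    ultimately have "\<nu> (\<sigma> w) \<bullet> proj_xy (E a b) + L (D b) \<bullet> proj_xy (D a) = 0"
      by (rule has_derivative_unique[THEN fun_cong])
    then show ?thesis by simp
  qed
  have "E a b = E b a" for a b unfolding E_def
    by (rule second_derivative_symmetric_vec[OF q(1) w q(2)])
  then have sym: "L (D b) \<bullet> proj_xy (D a) = L (D a) \<bullet> proj_xy (D b)" for a b
    unfolding LE by simp
  have "L (D h) = c *\<^sub>R proj_xy (D h)" for h
    unfolding c
  proof (rule derivative_unit_normal_eq[where n="\<nu> (\<sigma> w)"])
    show "\<nu> (\<sigma> w) \<bullet> proj_xy (D a) = 0" for a
      using orth[OF w] V(2,5) w by (simp add: D_def)
  qed (fact nL sym has_derivative_linear[OF L] has_derivative_linear[OF D] q(7)[OF w, folded D_def] V(4)[OF V(2)])+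
  then have "((\<lambda>z. \<nu> (\<sigma> z) - c *\<^sub>R proj_xy (\<sigma> z)) has_derivative (\<lambda>h. 0)) (at w)"
    using has_derivative_diff[OF G has_derivative_scaleR_right[OF bounded_linear.has_derivative[OF bounded_linear_proj_xy D], of c]]
    by simp
  then show ?thesis
    by (rule has_derivative_transform_within_open[OF _ W]) (use V(5) in \<open>simp add: W_def\<close>)
qed

section \<open>Components of the surface\<close>

text \<open>The map \<open>\<Phi>\<close> sweeps \<open>M\<close> out to an open set of \<open>real^3\<close>, so that invariance of domain in
  dimension 3 applies.\<close>

lemma openin_image_of_thickening:
  fixes \<sigma> :: "real^2 \<Rightarrow> real^3" and \<Phi> :: "real^3 \<Rightarrow> real \<Rightarrow> real^3"
  assumes B: "open B" "continuous_on B \<sigma>" "inj_on \<sigma> B" "\<sigma> ` B \<subseteq> M"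
    and cont: "continuous_on (M \<times> UNIV) (\<lambda>(m, s). \<Phi> m s)"
    and inj: "\<And>m m' s s'. m \<in> M \<Longrightarrow> m' \<in> M \<Longrightarrow> \<Phi> m s = \<Phi> m' s' \<Longrightarrow> m = m' \<and> s = s'"
    and zero: "\<And>m. m \<in> M \<Longrightarrow> \<Phi> m 0 = m"
  shows "openin (top_of_set M) (\<sigma> ` B)"
proof -
  define f where "f = (\<lambda>(w, s). \<Phi> (\<sigma> w) s)"
  have "continuous_on (B \<times> UNIV) (\<lambda>x. (\<lambda>(m, s). \<Phi> m s) (\<sigma> (fst x), snd x :: real))"
    using B by (intro continuous_on_compose2[OF cont] continuous_intros continuous_on_compose2[OF B(2)]) auto
  then have "continuous_on (B \<times> UNIV) f" by (simp add: f_def case_prod_beta)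
  moreover have "inj_on f (B \<times> UNIV)"
    using B(3,4) inj unfolding f_def inj_on_def by (auto simp: image_subset_iff) (metis inj)+
  ultimately have "open (f ` (B \<times> UNIV))"
    by (intro invariance_of_domain_gen) (auto simp: open_Times B(1))
  \<comment> \<open>A point \<open>p\<close> of \<open>M\<close> reached by the sweep also equals
    \<open>\<Phi> p 0\<close>, so by injectivity it is reached with parameter 0 and lies in the
    image of the patch.\<close>
  moreover have "\<sigma> ` B = M \<inter> f ` (B \<times> UNIV)"
  proof
    show "\<sigma> ` B \<subseteq> M \<inter> f ` (B \<times> UNIV)"
    proof
      fix p assume "p \<in> \<sigma> ` B"
      then obtain w where w: "w \<in> B" "p = \<sigma> w" by blast
      then have "p \<in> M" using B(4) by blast
      moreover have "f (w, 0) = p" using zero[OF \<open>p \<in> M\<close>] w(2) by (simp add: f_def)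
      ultimately show "p \<in> M \<inter> f ` (B \<times> UNIV)" using w(1) by force
    qed
    show "M \<inter> f ` (B \<times> UNIV) \<subseteq> \<sigma> ` B"
    proof
      fix p assume "p \<in> M \<inter> f ` (B \<times> UNIV)"
      then obtain w s where "p \<in> M" "w \<in> B" "\<Phi> (\<sigma> w) s = p" by (auto simp: f_def)
      then have "\<sigma> w = p" using inj[of "\<sigma> w" p s 0] zero B(4) by auto
      with \<open>w \<in> B\<close> show "p \<in> \<sigma> ` B" by blast
    qed
  qed
  ultimately show ?thesis by (auto simp: openin_open)
qed

section \<open>The two models: planes and cylinders\<close>

lemma openin_hyperplane_image:
  fixes \<sigma> :: "real^2 \<Rightarrow> real^3"
  assumes "n \<noteq> 0" "open B" "continuous_on B \<sigma>" "inj_on \<sigma> B" "\<sigma> ` B \<subseteq> {p. n \<bullet> p = d}"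
  shows "openin (top_of_set {p. n \<bullet> p = d}) (\<sigma> ` B)"
proof (rule openin_image_of_thickening[where \<Phi>="\<lambda>m s. m + s *\<^sub>R n", OF assms(2-)])
  show "continuous_on ({p. n \<bullet> p = d} \<times> UNIV) (\<lambda>(m, s). m + s *\<^sub>R n)"
    by (auto simp: case_prod_beta intro!: continuous_intros)
  fix m m' s s' assume *: "m \<in> {p. n \<bullet> p = d}" "m' \<in> {p. n \<bullet> p = d}" "m + s *\<^sub>R n = m' + s' *\<^sub>R n"
  have "n \<bullet> (m + s *\<^sub>R n) = n \<bullet> (m' + s' *\<^sub>R n)" by (simp only: *(3))
  then have "s * (n \<bullet> n) = s' * (n \<bullet> n)" using *(1,2) unfolding inner_add_right by simp
  then have "s = s'" using assms(1) by simp
  with * show "m = m' \<and> s = s'" by simp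
qed simp

lemma right_cylinder_iff: "p \<in> right_cylinder z R \<longleftrightarrow> norm (proj_xy p - z) = R"
  by (simp add: right_cylinder_def proj_xy_def dist_norm norm_minus_commute)

text \<open>The sweep dilates about the axis by the factor \<open>exp s\<close>. All points of the
  cylinder have the same positive distance from the axis, so the factor can be read off from the
  distance of the image.\<close>

lemma openin_right_cylinder_image:
  fixes \<sigma> :: "real^2 \<Rightarrow> real^3"
  assumes "R > 0" "open B" "continuous_on B \<sigma>" "inj_on \<sigma> B" "\<sigma> ` B \<subseteq> right_cylinder z R"
  shows "openin (top_of_set (right_cylinder z R)) (\<sigma> ` B)"
proof (rule openin_image_of_thickening[
      where \<Phi>="\<lambda>m s. (\<chi> i. if i = 1 then z$1 + exp s * (m$1 - z$1) else if i = 2 then z$2 + exp s * (m$2 - z$2) else m$3) :: real^3", OF assms(2-)])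
  show "continuous_on (right_cylinder z R \<times> UNIV)
     (\<lambda>(m, s). (\<chi> i. if i = 1 then z$1 + exp s * (m$1 - z$1) else if i = 2 then z$2 + exp s * (m$2 - z$2) else m$3) :: real^3)"
    unfolding case_prod_beta
    by (rule continuous_on_vec_lambda, case_tac "i = 1"; case_tac "i = 2") (auto intro!: continuous_intros)
  fix m m' s s' assume m: "m \<in> right_cylinder z R" "m' \<in> right_cylinder z R"
   and "(\<chi> i. if i = 1 then z$1 + exp s * (m$1 - z$1) else if i = 2 then z$2 + exp s * (m$2 - z$2) else m$3) =
    ((\<chi> i. if i = 1 then z$1 + exp s' * (m'$1 - z$1) else if i = 2 then z$2 + exp s' * (m'$2 - z$2) else m'$3) :: real^3)"
  then have *: "exp s * (m$1 - z$1) = exp s' * (m'$1 - z$1)" "exp s * (m$2 - z$2) = exp s' * (m'$2 - z$2)" "m$3 = m'$3"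
    by (simp_all add: eq_real3_iff)
  then have "exp s *\<^sub>R (proj_xy m - z) = exp s' *\<^sub>R (proj_xy m' - z)"
    by (simp add: eq_real2_iff)
  from arg_cong[OF this, of norm] have "s = s'"
    using m assms(1) by (simp add: right_cylinder_iff)
  with * show "m = m' \<and> s = s'" by (simp add: eq_real3_iff)
qed (simp add: eq_real3_iff)

lemma connected_right_cylinder: "connected (right_cylinder z R)"
proof -
  let ?f = "\<lambda>(q::real^2, t::real). (\<chi> i. if i = 1 then q$1 else if i = 2 then q$2 else t) :: real^3"
  have "right_cylinder z R = ?f ` (sphere z R \<times> UNIV)"
  proof (intro equalityI subsetI)
    fix p assume "p \<in> right_cylinder z R"
    then have "p = ?f (proj_xy p, p$3)" "proj_xy p \<in> sphere z R"
      by (simp_all add: eq_real3_iff right_cylinder_def proj_xy_def)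
    then show "p \<in> ?f ` (sphere z R \<times> UNIV)" by blast
  next
    fix p assume "p \<in> ?f ` (sphere z R \<times> UNIV)"
    then obtain q t where q: "q \<in> sphere z R" "p = ?f (q, t)" by blast
    then have "proj_xy p = q" by (simp add: eq_real2_iff)
    with q show "p \<in> right_cylinder z R" by (simp add: right_cylinder_def proj_xy_def)
  qed
  moreover have "connected (?f ` (sphere z R \<times> UNIV))"
  proof (rule connected_continuous_image)
    show "continuous_on (sphere z R \<times> UNIV) ?f"
      unfolding case_prod_beta
      by (rule continuous_on_vec_lambda, case_tac "i = 1"; case_tac "i = 2") (auto intro!: continuous_intros)
  qed (simp add: connected_Times connected_sphere)
  ultimately show ?thesis by simp
qed

section \<open>Patches inside a component\<close>

lemma regular_surface_patch:
  assumes "regular_surface A S" "(U, \<sigma>) \<in> A"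
  shows "surface_patch U \<sigma>" "openin (top_of_set S) (\<sigma> ` U)" "\<sigma> ` U \<subseteq> S"
  using assms unfolding regular_surface_def by fast+

lemma regular_surface_point:
  assumes "regular_surface A S" "p \<in> S"
  obtains U \<sigma> w where "(U, \<sigma>) \<in> A" "w \<in> U" "\<sigma> w = p"
  using assms unfolding regular_surface_def by fast

lemma openin_patch_image:
  assumes "regular_surface A S" "(U, \<sigma>) \<in> A" "open B" "B \<subseteq> U"
  shows "openin (top_of_set S) (\<sigma> ` B)"
proof -
  note p = regular_surface_patch[OF assms(1,2)]
  obtain g where "homeomorphism U (\<sigma> ` U) \<sigma> g" using p(1) by (auto simp: surface_patch_def)
  moreover have "openin (top_of_set U) B"
    using assms surface_patchD(1)[OF p(1)] by (simp add: openin_open_eq)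
  ultimately have "openin (top_of_set (\<sigma> ` U)) (\<sigma> ` B)"
    by (rule homeomorphism_imp_open_map)
  with p(2) show ?thesis by (blast intro: openin_trans)
qed

text \<open>The image of a ball is connected and meets \<open>C\<close>, so it cannot leave the
  component.\<close>

lemma component_patch_ball:
  assumes "regular_surface A S" "C \<in> components S" "(U, \<sigma>) \<in> A" "w \<in> U" "\<sigma> w \<in> C"
  obtains r where "r > 0" "ball w r \<subseteq> U" "\<sigma> ` ball w r \<subseteq> C"
proof -
  note p = regular_surface_patch[OF assms(1,3)] surface_patchD(1,4)[OF regular_surface_patch(1)[OF assms(1,3)]]
  obtain r where r: "r > 0" "ball w r \<subseteq> U" using p(4) assms(4) by (meson openE)
  have "connected (\<sigma> ` ball w r)"
    using continuous_on_subset[OF p(5) r(2)] by (intro connected_continuous_image) auto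
  moreover have "\<sigma> ` ball w r \<subseteq> S" using r(2) p(3) by blast
  moreover have "C \<inter> \<sigma> ` ball w r \<noteq> {}" using assms(5) r(1) by (auto simp: disjoint_iff)
  ultimately have "\<sigma> ` ball w r \<subseteq> C" using assms(2) by (metis components_maximal)
  with r that show ?thesis by blast
qed

text \<open>Differentiability is asked only of the composition with patches, since the functions of
  interest involve the normal, which is meaningful on the surface only.\<close>

lemma constant_on_component:
  fixes F :: "real^3 \<Rightarrow> 'b::real_normed_vector"
  assumes S: "regular_surface A S" and C: "C \<in> components S"
    and D: "\<And>U \<sigma> w. (U, \<sigma>) \<in> A \<Longrightarrow> w \<in> U \<Longrightarrow> \<sigma> w \<in> C \<Longrightarrow> ((\<lambda>z. F (\<sigma> z)) has_derivative (\<lambda>h. 0)) (at w)"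
    and pq: "p \<in> C" "q \<in> C"
  shows "F p = F q"
proof (rule connected_local_const[OF in_components_connected[OF C] pq, of F], rule ballI)
  fix a assume a: "a \<in> C"
  then have aS: "a \<in> S" using C in_components_subset by blast
  obtain U \<sigma> w where A: "(U, \<sigma>) \<in> A" "w \<in> U" "\<sigma> w = a"
    using S aS by (rule regular_surface_point)
  obtain r where r: "r > 0" "ball w r \<subseteq> U" "\<sigma> ` ball w r \<subseteq> C"
    by (rule component_patch_ball[OF S C A(1,2)]) (use a A(3) in simp)
  have "\<exists>c. \<forall>x\<in>ball w r. F (\<sigma> x) = c"
  proof (rule has_derivative_zero_constant)
    show "((\<lambda>x. F (\<sigma> x)) has_derivative (\<lambda>h. 0)) (at x within ball w r)" if "x \<in> ball w r" for x
      by (rule has_derivative_at_withinI, rule D[OF A(1)]) (use r that in blast)+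
  qed simp
  then have const: "F (\<sigma> x) = F a" if "x \<in> ball w r" for x
    using that r(1) A(3) by (metis centre_in_ball)
  \<comment> \<open>Images of balls are relatively open, so every point of \<open>C\<close> near
    \<open>a\<close> has a parameter in the same ball.\<close>
  obtain T where T: "open T" "\<sigma> ` ball w r = S \<inter> T"
    using openin_patch_image[OF S A(1) open_ball r(2)] by (auto simp: openin_open)
  have "a \<in> T" using T(2) A(3) r(1) by (metis IntE centre_in_ball imageI)
  moreover have "F a = F b" if "b \<in> T" "b \<in> C" for b
  proof -
    have "b \<in> \<sigma> ` ball w r" using T(2) that C in_components_subset by blast
    then show ?thesis using const by auto
  qed
  ultimately show "\<forall>\<^sub>F b in at a within C. F a = F b"
    using T(1) unfolding eventually_at_topological by blast
qed

text \<open>The hypothesis \<open>M\<close> is the form in which invariance of domain holds for a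
  plane or a cylinder. It makes \<open>C\<close> open in the model; a component that is also closed
  is a nonempty clopen subset of a connected space.\<close>

lemma openin_component_of_model:
  assumes S: "regular_surface A S" and C: "C \<in> components S" "C \<subseteq> M"
    and M: "\<And>B (\<sigma> :: real^2 \<Rightarrow> real^3). open B \<Longrightarrow> continuous_on B \<sigma> \<Longrightarrow> inj_on \<sigma> B \<Longrightarrow> \<sigma> ` B \<subseteq> M
       \<Longrightarrow> openin (top_of_set M) (\<sigma> ` B)"
    and conn: "connected M"
  shows "openin (top_of_set M) C \<and> (closed C \<longrightarrow> C = M)"
proof -
  have "openin (top_of_set M) C"
  proof (subst openin_subopen, rule ballI)
    fix a assume a: "a \<in> C"
    then have aS: "a \<in> S" using C in_components_subset by blast
    obtain U \<sigma> w where A: "(U, \<sigma>) \<in> A" "w \<in> U" "\<sigma> w = a"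
      using S aS by (rule regular_surface_point)
    obtain r where r: "r > 0" "ball w r \<subseteq> U" "\<sigma> ` ball w r \<subseteq> C"
        by (rule component_patch_ball[OF S C(1) A(1,2)]) (use a A(3) in simp)
    note p = surface_patchD[OF regular_surface_patch(1)[OF S A(1)]]
    have "openin (top_of_set M) (\<sigma> ` ball w r)"
      using r C(2) continuous_on_subset[OF p(4)] inj_on_subset[OF p(3)] by (intro M) auto
    then show "\<exists>T. openin (top_of_set M) T \<and> a \<in> T \<and> T \<subseteq> C"
      using r A(3) by (metis centre_in_ball imageI)
  qed
  moreover have "C \<noteq> {}" using C(1) in_components_nonempty by blast
  ultimately show ?thesis
    using conn C(2) unfolding connected_clopen by (meson closed_subset)
qed

lemma component_of_constant_curvature_surface:
  assumes S: "regular_surface A S" and nonchar: "characteristic_locus A = {}" and closed: "closed_induced_form A"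
    and H: "\<forall>p\<in>S. has_horizontal_mean_curvature A p c" and C: "C \<in> components S"
  shows "(c = 0 \<and>
          (\<exists>P. vertical_plane P \<and> openin (top_of_set P) C \<and> (closed C \<longrightarrow> C = P))) \<or>
         (\<exists>z R. R > 0 \<and> (c = 1 / R \<or> c = - (1 / R)) \<and>
          openin (top_of_set (right_cylinder z R)) C \<and>
          (closed C \<longrightarrow> C = right_cylinder z R))"
proof -
  \<comment> \<open>The unit normal as a function of the point. The choice among patches is
    harmless: the extension in the definition of curvature takes one value at the point and agrees
    there with every patch.\<close>
  define n where "n = (\<lambda>p. SOME n. \<exists>U \<sigma> w. (U, \<sigma>) \<in> A \<and> w \<in> U \<and> \<sigma> w = p \<and> n = sgn (horizontal_normal \<sigma> w))"
  have n: "n (\<sigma> w) = sgn (horizontal_normal \<sigma> w)" if A: "(U, \<sigma>) \<in> A" "w \<in> U" for U \<sigma> w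
  proof -
    have "\<exists>U' \<sigma>' w'. (U', \<sigma>') \<in> A \<and> w' \<in> U' \<and> \<sigma>' w' = \<sigma> w \<and> n (\<sigma> w) = sgn (horizontal_normal \<sigma>' w')"
      unfolding n_def by (rule someI[of _ "sgn (horizontal_normal \<sigma> w)"]) (use A in blast)
    then obtain U' \<sigma>' w' where A': "(U', \<sigma>') \<in> A" "w' \<in> U'" "\<sigma>' w' = \<sigma> w" "n (\<sigma> w) = sgn (horizontal_normal \<sigma>' w')"
      by blast
    have "\<sigma> w \<in> S" using regular_surface_patch(3)[OF S A(1)] A(2) by blast
    with H have "has_horizontal_mean_curvature A (\<sigma> w) c" by blast
    then obtain V and \<nu> :: "real^3 \<Rightarrow> real^2" where V: "\<sigma> w \<in> V"
      and \<nu>: "\<forall>(U, \<sigma>)\<in>A. \<forall>w\<in>U. \<sigma> w \<in> V \<longrightarrow> \<nu> (\<sigma> w) = sgn (horizontal_normal \<sigma> w)"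
      unfolding has_horizontal_mean_curvature_def by (elim exE conjE) (rule that, assumption+)
    have "\<nu> (\<sigma> w) = sgn (horizontal_normal \<sigma> w)" "\<nu> (\<sigma>' w') = sgn (horizontal_normal \<sigma>' w')"
      using bspec[OF \<nu> A(1)] bspec[OF \<nu> A'(1)] A(2) A'(2,3) V by auto
    then show ?thesis using A'(3,4) by simp
  qed
  define F where "F = (\<lambda>p. n p - c *\<^sub>R proj_xy p)"
  have open_U: "open U" if "(U, \<sigma>) \<in> A" for U \<sigma>
    using surface_patchD(1)[OF regular_surface_patch(1)[OF S that]] .
  have F: "((\<lambda>z. F (\<sigma> z)) has_derivative (\<lambda>h. 0)) (at w)" if A: "(U, \<sigma>) \<in> A" "w \<in> U" for U \<sigma> w
  proof (rule has_derivative_transform_within_open[OF _ open_U[OF A(1)] A(2)])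
    show "((\<lambda>z. sgn (horizontal_normal \<sigma> z) - c *\<^sub>R proj_xy (\<sigma> z)) has_derivative (\<lambda>h. 0)) (at w)"
      using A H regular_surface_patch(3)[OF S A(1)]
      by (intro unit_normal_minus_position_has_derivative_0[OF A(1) regular_surface_patch(1)[OF S A(1)] A(2) closed]) blast
  qed (simp add: F_def n[OF A(1)])
  have unit: "norm (n p) = 1" if p: "p \<in> S" for p
  proof -
    obtain U \<sigma> w where A: "(U, \<sigma>) \<in> A" "w \<in> U" "\<sigma> w = p"
      using S p by (rule regular_surface_point)
    then have "horizontal_normal \<sigma> w \<noteq> 0" using nonchar by (auto simp: characteristic_locus_def)
    then show ?thesis using n[OF A(1,2)] A(3) by (simp add: norm_sgn)
  qed
  obtain p0 where p0: "p0 \<in> C" using in_components_nonempty[OF C] by blast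
  have CS: "C \<subseteq> S" using C by (rule in_components_subset)
  have F0: "F p = F p0" if "p \<in> C" for p
    by (rule constant_on_component[OF S C _ that p0]) (rule F)
  show ?thesis
  proof (cases "c = 0")
    case True
    define m where "m = n p0"
    have nm: "n p = m" if "p \<in> C" for p using F0[OF that] by (simp add: F_def True m_def)
    define m3 :: "real^3" where "m3 = vector [m$1, m$2, 0]"
    define d where "d = m3 \<bullet> p0"
    have m3: "m3 \<bullet> p = m \<bullet> proj_xy p" for p by (simp add: m3_def inner_real3 inner_real2)
    have "m \<noteq> 0" using unit[of p0] p0 CS by (auto simp: m_def)
    then have m0: "m3 \<noteq> 0" by (auto simp: m3_def eq_real3_iff eq_real2_iff)
    have "m \<bullet> proj_xy p = m \<bullet> proj_xy p0" if p: "p \<in> C" for p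
    proof (rule constant_on_component[OF S C _ p p0])
      fix U \<sigma> w assume A: "(U, \<sigma>) \<in> A" "w \<in> U" "\<sigma> w \<in> C"
      note patch = regular_surface_patch(1)[OF S A(1)]
      have "m \<bullet> proj_xy (frechet_derivative \<sigma> (at w) a) = 0" for a
        using closed A horizontal_normal_orthogonal[OF patch A(2), of a] n[OF A(1,2)] nm[OF A(3)]
        by (auto simp: closed_induced_form_def)
      moreover have "((\<lambda>z. m \<bullet> proj_xy (\<sigma> z)) has_derivative
          (\<lambda>h. m \<bullet> proj_xy (frechet_derivative \<sigma> (at w) h))) (at w)"
        by (intro has_derivative_inner_right bounded_linear.has_derivative[OF bounded_linear_proj_xy]
            has_derivative_frechet_derivative surface_patchD(5)[OF patch A(2)])
      ultimately show "((\<lambda>z. m \<bullet> proj_xy (\<sigma> z)) has_derivative (\<lambda>h. 0)) (at w)" by simp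
    qed
    then have "C \<subseteq> {p. m3 \<bullet> p = d}" by (auto simp: m3 d_def)
    then have "openin (top_of_set {p. m3 \<bullet> p = d}) C \<and> (closed C \<longrightarrow> C = {p. m3 \<bullet> p = d})"
      by (rule openin_component_of_model[OF S C])
        (auto intro: openin_hyperplane_image[OF m0] convex_connected convex_hyperplane)
    moreover have "vertical_plane {p. m3 \<bullet> p = d}"
      unfolding vertical_plane_def using m0 by (metis m3_def vector_3(3))
    ultimately show ?thesis using True by blast
  next
    case False
    define R where "R = 1 / \<bar>c\<bar>"
    \<comment> \<open>Solving \<open>n p - c q = F p0\<close> for the projection \<open>q\<close> of
      \<open>p\<close> gives \<open>q - z = n p / c\<close>, a vector of length
      \<open>1 / \<bar>c\<bar>\<close>.\<close>
    define z where "z = - (1 / c) *\<^sub>R F p0"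
    have R: "R > 0" "c = 1 / R \<or> c = - (1 / R)" using False by (auto simp: R_def abs_if)
    have "C \<subseteq> right_cylinder z R"
    proof
      fix p assume p: "p \<in> C"
      have "proj_xy p - z = (1 / c) *\<^sub>R n p"
        using False by (simp add: z_def F0[OF p, symmetric]) (simp add: F_def scaleR_diff_right)
      then show "p \<in> right_cylinder z R"
        using unit[of p] p CS by (auto simp: right_cylinder_iff R_def)
    qed
    then have "openin (top_of_set (right_cylinder z R)) C \<and> (closed C \<longrightarrow> C = right_cylinder z R)"
      by (rule openin_component_of_model[OF S C])
        (auto intro: openin_right_cylinder_image[OF R(1)] connected_right_cylinder)
    then show ?thesis using R by blast
  qed
qed

section \<open>Surfaces with a vertical tangent plane\<close>

text \<open>The converse at a single point. If all projected tangent vectors are multiples of one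
  vector, \<open>dx \<and> dy\<close> pulls back to 0, and the factor \<open>k\<close> is the
  determinant that \<open>tangent_plane_coordinates\<close> shows to be nonzero.\<close>

lemma vertical_patch:
  assumes p: "surface_patch U \<sigma>" and w: "w \<in> U" and unit: "norm n = 1"
    and orth: "\<And>a. n \<bullet> proj_xy (frechet_derivative \<sigma> (at w) a) = 0"
  shows "ext_deriv (induced_form \<sigma>) w a b = 0"
    and "\<exists>k. k \<noteq> 0 \<and> horizontal_normal \<sigma> w = k *\<^sub>R n"
proof -
  note q = surface_patchD(5,6,7)[OF p w]
  define D where "D = frechet_derivative \<sigma> (at w)"
  define s where "s = (\<lambda>a. n$1 * D a $ 2 - n$2 * D a $ 1)"
  have s: "n$1 * D a $ 2 - n$2 * D a $ 1 = s a" for a by (simp add: s_def)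
  note Ds = tangent_plane_coordinates[OF q(2,3) unit orth, folded D_def, unfolded s]
  show "ext_deriv (induced_form \<sigma>) w a b = 0"
    unfolding ext_deriv_induced_form[OF p w] D_def[symmetric] Ds by simp
  show "\<exists>k. k \<noteq> 0 \<and> horizontal_normal \<sigma> w = k *\<^sub>R n"
    using Ds(3)
    by (intro exI[of _ "s (axis 1 1) * D (axis 2 1) $ 3 - s (axis 2 1) * D (axis 1 1) $ 3"])
      (simp add: eq_real2_iff horizontal_normal_nth[OF q(1), folded D_def] Ds(1,2) algebra_simps)
qed

text \<open>The components of the horizontal normal are linear combinations of 2-by-2 minors of the
  differential, so the chain rule multiplies them by the Jacobian determinant of the transition map,
  which is positive.\<close>

lemma horizontal_normal_transition:
  assumes S: "regular_surface A S" and A: "(U, \<sigma>) \<in> A" "(U', \<sigma>') \<in> A"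
    and w: "w \<in> U" "w' \<in> U'" "\<sigma> w = \<sigma>' w'"
  shows "\<exists>d>0. horizontal_normal \<sigma> w = d *\<^sub>R horizontal_normal \<sigma>' w'"
proof -
  note p = surface_patchD[OF regular_surface_patch(1)[OF S A(1)]]
  note p' = surface_patchD[OF regular_surface_patch(1)[OF S A(2)]]
  define \<phi> where "\<phi> = inv_into U' \<sigma>' \<circ> \<sigma>"
  have "orientation_preserving_transition (U, \<sigma>) (U', \<sigma>')"
    using S A unfolding regular_surface_def by blast
  then obtain D where D: "(\<phi> has_derivative D) (at w)" "det (matrix D) > 0"
    using w unfolding orientation_preserving_transition_def \<phi>_def by auto
  have \<phi>w: "\<phi> w = w'"
    using w p'(3) by (simp add: \<phi>_def)
  obtain T where T: "open T" "\<sigma>' ` U' = S \<inter> T"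
    using regular_surface_patch(2)[OF S A(2)] by (auto simp: openin_open)
  \<comment> \<open>On this open set \<sigma> takes values in the image of \<open>\<sigma>'\<close>,
    so \<open>\<phi>\<close> is a true transition map and \<sigma> factors through
    \<open>\<sigma>'\<close>.\<close>
  have W: "open (U \<inter> \<sigma> -` T)" "w \<in> U \<inter> \<sigma> -` T"
    using continuous_open_preimage[OF p(4,1) T(1)] w T(2) by auto
  define d' where "d' = frechet_derivative \<sigma>' (at w')"
  have "((\<lambda>z. \<sigma>' (\<phi> z)) has_derivative (\<lambda>h. d' (D h))) (at w)"
    unfolding d'_def
    by (rule has_derivative_compose[OF D(1)]) (simp add: \<phi>w has_derivative_frechet_derivative[OF p'(5)[OF w(2)]])
  then have "(\<sigma> has_derivative (\<lambda>h. d' (D h))) (at w)"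
  proof (rule has_derivative_transform_within_open[OF _ W])
    fix z assume "z \<in> U \<inter> \<sigma> -` T"
    then have "\<sigma> z \<in> \<sigma>' ` U'" using T(2) regular_surface_patch(3)[OF S A(1)] by blast
    then show "\<sigma>' (\<phi> z) = \<sigma> z" by (simp add: \<phi>_def f_inv_into_f)
  qed
  note D\<sigma> = frechet_derivativeI[OF this]
  define u' v' where "u' = d' (axis 1 1)" and "v' = d' (axis 2 1)"
  have d': "d' h = h$1 *\<^sub>R u' + h$2 *\<^sub>R v'" for h
    unfolding d'_def u'_def v'_def by (rule linear_real2_expand[OF p'(6)[OF w(2)]])
  have det: "det (matrix D) = D (axis 1 1) $ 1 * D (axis 2 1) $ 2 - D (axis 2 1) $ 1 * D (axis 1 1) $ 2"
    by (simp add: det_2 matrix_def)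
  have "horizontal_normal \<sigma> w = det (matrix D) *\<^sub>R horizontal_normal \<sigma>' w'"
    unfolding eq_real2_iff vector_scaleR_component horizontal_normal_nth[OF p(5)[OF w(1)]]
      horizontal_normal_nth[OF p'(5)[OF w(2)], folded d'_def, folded u'_def v'_def] D\<sigma> d' det
    by (simp add: w(3) algebra_simps)
  with D(2) show ?thesis by blast
qed

text \<open>Common to planes and cylinders. Given one unit field \<open>\<nu>\<close> around the
  surface that is orthogonal to its projected tangent vectors, the unit horizontal normal of any
  atlas is \<open>\<nu>\<close> up to a global sign \<open>e\<close>. Hence \<open>e\<close> times
  \<open>\<nu>\<close> is an admissible extension, and the curvature is \<open>e\<close> times the
  divergence of \<open>\<nu>\<close> along X and Y.\<close>

lemma vertical_surface:
  fixes \<nu> :: "real^3 \<Rightarrow> real^2"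
  assumes S: "regular_surface A S" and conn: "connected S"
    and V: "open V" "S \<subseteq> V" and \<nu>: "smooth_on V \<nu>" "\<And>q. q \<in> V \<Longrightarrow> norm (\<nu> q) = 1"
    and orth: "\<And>U \<sigma> w a. surface_patch U \<sigma> \<Longrightarrow> \<sigma> ` U \<subseteq> S \<Longrightarrow> w \<in> U \<Longrightarrow>
      \<nu> (\<sigma> w) \<bullet> proj_xy (frechet_derivative \<sigma> (at w) a) = 0"
  shows "characteristic_locus A = {}" "closed_induced_form A"
    and "\<exists>e. (e = 1 \<or> e = -1) \<and>
      (\<forall>U \<sigma> w. (U, \<sigma>) \<in> A \<longrightarrow> w \<in> U \<longrightarrow> sgn (horizontal_normal \<sigma> w) = e *\<^sub>R \<nu> (\<sigma> w)) \<and>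
      (\<forall>p\<in>S. has_horizontal_mean_curvature A p
         (e * (frechet_derivative \<nu> (at p) (heis_X p) $ 1 + frechet_derivative \<nu> (at p) (heis_Y p) $ 2)))"
proof -
  have patch: "(\<exists>k. k \<noteq> 0 \<and> horizontal_normal \<sigma> w = k *\<^sub>R \<nu> (\<sigma> w)) \<and> ext_deriv (induced_form \<sigma>) w a b = 0"
    "norm (\<nu> (\<sigma> w)) = 1" if A: "(U, \<sigma>) \<in> A" "w \<in> U" for U \<sigma> w a b
  proof -
    note p = regular_surface_patch[OF S A(1)]
    show unit: "norm (\<nu> (\<sigma> w)) = 1" using p(3) A(2) V(2) \<nu>(2) by blast
    show "(\<exists>k. k \<noteq> 0 \<and> horizontal_normal \<sigma> w = k *\<^sub>R \<nu> (\<sigma> w)) \<and> ext_deriv (induced_form \<sigma>) w a b = 0"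
      using vertical_patch[OF p(1) A(2) unit orth[OF p(1,3) A(2)]] by blast
  qed
  show "characteristic_locus A = {}"
    using patch unfolding characteristic_locus_def by fastforce
  show "closed_induced_form A"
    using patch unfolding closed_induced_form_def by blast
  \<comment> \<open>Since the normal is a multiple of the unit vector \<open>\<nu>\<close>, this is
    the nonzero factor, and its sign compares the orientation with \<open>\<nu>\<close>.\<close>
  define g where "g = (\<lambda>\<sigma> w. horizontal_normal \<sigma> w \<bullet> \<nu> (\<sigma> w))"
  have g: "g \<sigma> w \<noteq> 0" "sgn (horizontal_normal \<sigma> w) = sgn (g \<sigma> w) *\<^sub>R \<nu> (\<sigma> w)"
    if A: "(U, \<sigma>) \<in> A" "w \<in> U" for U \<sigma> w
  proof -
    obtain k where k: "k \<noteq> 0" "horizontal_normal \<sigma> w = k *\<^sub>R \<nu> (\<sigma> w)" using patch(1)[OF A] by blast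
    have "\<nu> (\<sigma> w) \<bullet> \<nu> (\<sigma> w) = 1" using patch(2)[OF A] by (simp add: norm_eq_1)
    then have "g \<sigma> w = k" by (simp add: g_def k(2))
    moreover have "sgn (\<nu> (\<sigma> w)) = \<nu> (\<sigma> w)" using patch(2)[OF A] by (simp add: sgn_div_norm)
    ultimately show "g \<sigma> w \<noteq> 0" "sgn (horizontal_normal \<sigma> w) = sgn (g \<sigma> w) *\<^sub>R \<nu> (\<sigma> w)"
      using k by (simp_all add: sgn_scaleR)
  qed
  have g_unique: "sgn (g \<sigma> w) = sgn (g \<sigma>' w')"
    if A: "(U, \<sigma>) \<in> A" "(U', \<sigma>') \<in> A" "w \<in> U" "w' \<in> U'" "\<sigma> w = \<sigma>' w'" for U \<sigma> w U' \<sigma>' w'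
    using horizontal_normal_transition[OF S A] A(5) by (auto simp: g_def sgn_mult)
  define e where "e = (\<lambda>p. SOME e. \<exists>U \<sigma> w. (U, \<sigma>) \<in> A \<and> w \<in> U \<and> \<sigma> w = p \<and> e = sgn (g \<sigma> w))"
  have e: "e (\<sigma> w) = sgn (g \<sigma> w)" if A: "(U, \<sigma>) \<in> A" "w \<in> U" for U \<sigma> w
  proof -
    have "\<exists>U' \<sigma>' w'. (U', \<sigma>') \<in> A \<and> w' \<in> U' \<and> \<sigma>' w' = \<sigma> w \<and> e (\<sigma> w) = sgn (g \<sigma>' w')"
      unfolding e_def by (rule someI[of _ "sgn (g \<sigma> w)"]) (use A in blast)
    then show ?thesis using g_unique A by metis
  qed
  have e_const: "e p = e q" if pq: "p \<in> S" "q \<in> S" for p q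
  proof (rule connected_local_const[OF conn pq, of e], rule ballI)
    fix a assume "a \<in> S"
    with S obtain U \<sigma> w where A: "(U, \<sigma>) \<in> A" "w \<in> U" "\<sigma> w = a"
      by (rule regular_surface_point)
    note p = surface_patchD[OF regular_surface_patch(1)[OF S A(1)]]
    have c: "continuous_on U (\<lambda>z. frechet_derivative \<sigma> (at z) v)" for v
      by (rule smooth_on_imp_continuous_on[OF smooth_on_frechet_derivative[OF p(2)]])
    have c\<nu>: "continuous_on U (\<lambda>z. \<nu> (\<sigma> z))"
      using regular_surface_patch(3)[OF S A(1)] V(2)
      by (intro continuous_on_compose2[OF smooth_on_imp_continuous_on[OF \<nu>(1)] p(4)]) auto
    \<comment> \<open>Positivity of this product expresses equality of signs as an open
      condition.\<close>
    have "continuous_on U (\<lambda>z. g \<sigma> z * g \<sigma> w)"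
      unfolding g_def[abs_def] inner_real2
      by (simp add: horizontal_normal_nth[OF p(5)] cong: continuous_on_cong)
        (intro continuous_intros c c\<nu> p(4))
    from continuous_open_preimage[OF this p(1), of "{0<..}"]
    have W: "open (U \<inter> (\<lambda>z. g \<sigma> z * g \<sigma> w) -` {0<..})" (is "open ?W") by simp
    have w: "w \<in> ?W" using A g(1)[OF A(1,2)] by (simp add: zero_less_mult_iff) linarith
    obtain T where T: "open T" "\<sigma> ` ?W = S \<inter> T"
      using openin_patch_image[OF S A(1) W] by (auto simp: openin_open)
    have "a \<in> T" using T(2) A(3) w by (metis IntE imageI)
    moreover have "e a = e b" if b: "b \<in> T" "b \<in> S" for b
    proof -
      have "b \<in> \<sigma> ` ?W" using T(2) b by blast
      then obtain z where z: "z \<in> U" "g \<sigma> z * g \<sigma> w > 0" "b = \<sigma> z" by auto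
      then have "sgn (g \<sigma> z) = sgn (g \<sigma> w)" by (auto simp: zero_less_mult_iff)
      then show ?thesis using e[OF A(1)] A(2,3) z by metis
    qed
    ultimately show "\<forall>\<^sub>F b in at a within S. e a = e b"
      using T(1) unfolding eventually_at_topological by blast
  qed
  \<comment> \<open>On the empty surface either sign will do.\<close>
  obtain \<epsilon> where \<epsilon>: "\<epsilon> = 1 \<or> \<epsilon> = - 1" "\<And>p. p \<in> S \<Longrightarrow> e p = \<epsilon>"
  proof (cases "S = {}")
    case False
    then obtain p where p: "p \<in> S" by blast
    with S obtain U \<sigma> w where A: "(U, \<sigma>) \<in> A" "w \<in> U" "\<sigma> w = p"
      by (rule regular_surface_point)
    have "e p = 1 \<or> e p = -1" using e[OF A(1,2)] g(1)[OF A(1,2)] A(3) by (auto simp: sgn_if)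
    with e_const p that show ?thesis by metis
  qed (use that in blast)
  have sgn_eq: "sgn (horizontal_normal \<sigma> w) = \<epsilon> *\<^sub>R \<nu> (\<sigma> w)" if A: "(U, \<sigma>) \<in> A" "w \<in> U" for U \<sigma> w
    using g(2)[OF A] e[OF A] \<epsilon>(2) regular_surface_patch(3)[OF S A(1)] A(2) by auto
  have "has_horizontal_mean_curvature A p
         (\<epsilon> * (frechet_derivative \<nu> (at p) (heis_X p) $ 1 + frechet_derivative \<nu> (at p) (heis_Y p) $ 2))"
    if p: "p \<in> S" for p
    unfolding has_horizontal_mean_curvature_def
  proof (intro exI[of _ V] exI[of _ "\<lambda>q. \<epsilon> *\<^sub>R \<nu> q"] conjI)
    show "open V" "p \<in> V" using V p by auto
    show "smooth_on V (\<lambda>q. \<epsilon> *\<^sub>R \<nu> q)"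
      by (rule smooth_on_bounded_linear[OF bounded_linear_scaleR_right V(1) \<nu>(1)])
    show "\<forall>q\<in>V. norm (\<epsilon> *\<^sub>R \<nu> q) = 1" using \<epsilon>(1) \<nu>(2) by auto
    show "\<forall>(U, \<sigma>)\<in>A. \<forall>w\<in>U. \<sigma> w \<in> V \<longrightarrow> \<epsilon> *\<^sub>R \<nu> (\<sigma> w) = sgn (horizontal_normal \<sigma> w)"
      using sgn_eq by auto
    have "p \<in> V" using V p by auto
    then have "((\<lambda>q. (\<epsilon> *\<^sub>R \<nu> q) $ i) has_derivative (\<lambda>h. \<epsilon> * frechet_derivative \<nu> (at p) h $ i)) (at p)" for i
      using frechet_derivative_vec_nth(1)[OF smooth_on_imp_differentiable[OF \<nu>(1)]]
      by (auto intro!: has_derivative_mult_right)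
    note * = frechet_derivativeI[OF this]
    show "\<epsilon> * (frechet_derivative \<nu> (at p) (heis_X p) $ 1 + frechet_derivative \<nu> (at p) (heis_Y p) $ 2) =
      frechet_derivative (\<lambda>q. (\<epsilon> *\<^sub>R \<nu> q) $ 1) (at p) (heis_X p) +
      frechet_derivative (\<lambda>q. (\<epsilon> *\<^sub>R \<nu> q) $ 2) (at p) (heis_Y p)"
      unfolding * by (simp add: algebra_simps)
  qed
  with \<epsilon>(1) sgn_eq show "\<exists>e. (e = 1 \<or> e = -1) \<and>
      (\<forall>U \<sigma> w. (U, \<sigma>) \<in> A \<longrightarrow> w \<in> U \<longrightarrow> sgn (horizontal_normal \<sigma> w) = e *\<^sub>R \<nu> (\<sigma> w)) \<and>
      (\<forall>p\<in>S. has_horizontal_mean_curvature A p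
         (e * (frechet_derivative \<nu> (at p) (heis_X p) $ 1 + frechet_derivative \<nu> (at p) (heis_Y p) $ 2)))"
    by blast
qed

section \<open>Planes and cylinders\<close>

lemma smooth_on_real3:
  fixes f :: "'a::real_normed_vector \<Rightarrow> real^3"
  assumes "open S" "smooth_on S (\<lambda>x. f x $ 1)" "smooth_on S (\<lambda>x. f x $ 2)" "smooth_on S (\<lambda>x. f x $ 3)"
  shows "smooth_on S f"
  using assms(2-) exhaust_3 by (intro smooth_on_vec[OF assms(1)]) metis

lemma smooth_on_real2:
  fixes f :: "'a::real_normed_vector \<Rightarrow> real^2"
  assumes "open S" "smooth_on S (\<lambda>x. f x $ 1)" "smooth_on S (\<lambda>x. f x $ 2)"
  shows "smooth_on S f"
  using assms(2-) exhaust_2 by (intro smooth_on_vec[OF assms(1)]) metis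

lemma norm_real2: "norm (w :: real^2) = sqrt (w$1 * w$1 + w$2 * w$2)"
  by (simp add: norm_eq_sqrt_inner inner_real2)

text \<open>A left inverse that is differentiable on all of space provides the homeomorphism and, by
  the chain rule, an injective differential. The only transition map is the identity.\<close>

lemma regular_surface_single_patch:
  assumes U: "open U" and \<sigma>: "smooth_on U \<sigma>" and S: "\<sigma> ` U = S"
    and g: "\<And>p. (g has_derivative g' p) (at p)" and g\<sigma>: "\<And>w. w \<in> U \<Longrightarrow> g (\<sigma> w) = w"
  shows "regular_surface {(U, \<sigma>)} S"
proof -
  have inj: "inj_on \<sigma> U" using g\<sigma> by (metis inj_onI)
  have "homeomorphism U (\<sigma> ` U) \<sigma> g"
    using g\<sigma> smooth_on_imp_continuous_on[OF \<sigma>] has_derivative_continuous[OF g]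
    by (intro homeomorphismI) (auto intro: continuous_at_imp_continuous_on)
  moreover have "rank (matrix (frechet_derivative \<sigma> (at w))) = 2" if w: "w \<in> U" for w
  proof -
    let ?D = "frechet_derivative \<sigma> (at w)"
    have d: "(\<sigma> has_derivative ?D) (at w)"
      using smooth_on_imp_differentiable[OF \<sigma> w] by (rule has_derivative_frechet_derivative)
    have "((\<lambda>z. g (\<sigma> z)) has_derivative (\<lambda>h. g' (\<sigma> w) (?D h))) (at w)"
      by (rule has_derivative_compose[OF d g])
    then have "((\<lambda>z. z) has_derivative (\<lambda>h. g' (\<sigma> w) (?D h))) (at w)"
      by (rule has_derivative_transform_within_open[OF _ U w]) (rule g\<sigma>)
    then have "(\<lambda>h. g' (\<sigma> w) (?D h)) = (\<lambda>h. h)"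
      by (rule has_derivative_unique) (rule has_derivative_ident)
    then have "inj ?D" by (metis injI)
    moreover have "(*v) (matrix ?D) = ?D"
      using matrix_works[OF has_derivative_linear[OF d, unfolded linear_matrix_vector_mul_eq[symmetric]]]
      by (simp add: fun_eq_iff)
    ultimately have "rank (matrix ?D) = CARD(2)" unfolding full_rank_injective by simp
    then show ?thesis by simp
  qed
  ultimately have "surface_patch U \<sigma>"
    using U \<sigma> unfolding surface_patch_def by blast
  moreover have "orientation_preserving_transition (U, \<sigma>) (U, \<sigma>)"
  proof -
    have "(inv_into U \<sigma> \<circ> \<sigma> has_derivative (\<lambda>h. h)) (at w)" if "w \<in> U" for w
      by (rule has_derivative_transform_within_open[OF has_derivative_ident U that]) (simp add: inj)
    moreover have "det (matrix (\<lambda>h::real^2. h)) > 0" by (simp add: det_2 matrix_def)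
    ultimately show ?thesis unfolding orientation_preserving_transition_def by blast
  qed
  ultimately show ?thesis
    using S by (auto simp: regular_surface_def)
qed

section \<open>Vertical planes\<close>

lemma plane_surface:
  assumes n: "n \<noteq> 0" "n$3 = 0" and S: "regular_surface A {p. n \<bullet> p = d}"
  shows "characteristic_locus A = {}" "closed_induced_form A"
    "\<forall>p\<in>{p. n \<bullet> p = d}. has_horizontal_mean_curvature A p 0"
proof -
  have np: "n \<bullet> p = proj_xy n \<bullet> proj_xy p" for p
    using n(2) by (simp add: inner_real2 inner_real3)
  have n0: "proj_xy n \<noteq> 0" using n by (auto simp: eq_real2_iff eq_real3_iff)
  have orth: "sgn (proj_xy n) \<bullet> proj_xy (frechet_derivative \<sigma> (at w) a) = 0"
    if p: "surface_patch U \<sigma>" "\<sigma> ` U \<subseteq> {p. n \<bullet> p = d}" "w \<in> U" for U \<sigma> w a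
  proof -
    note q = surface_patchD(1,5)[OF p(1)]
    have "((\<lambda>z. n \<bullet> \<sigma> z) has_derivative (\<lambda>h. n \<bullet> frechet_derivative \<sigma> (at w) h)) (at w)"
      by (intro has_derivative_inner_right has_derivative_frechet_derivative q(2)[OF p(3)])
    moreover have "((\<lambda>z. n \<bullet> \<sigma> z) has_derivative (\<lambda>h. 0)) (at w)"
      by (rule has_derivative_transform_within_open[OF has_derivative_const[of d] q(1) p(3)]) (use p(2) in auto)
    ultimately have "n \<bullet> frechet_derivative \<sigma> (at w) a = 0"
      by (rule has_derivative_unique[THEN fun_cong])
    then show ?thesis by (simp add: np sgn_div_norm)
  qed
  have "connected {p. n \<bullet> p = d}" by (intro convex_connected convex_hyperplane)
  \<comment> \<open>The normal extends as a constant field; its derivative vanishes, so the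
    undetermined sign has no effect on the curvature.\<close>
  note * = vertical_surface[OF S this open_UNIV subset_UNIV smooth_on_const[of _ "sgn (proj_xy n)"]]
  show "characteristic_locus A = {}"
    by (rule *(1)) (use n0 in \<open>simp add: norm_sgn\<close>, erule (2) orth)
  show "closed_induced_form A"
    by (rule *(2)) (use n0 in \<open>simp add: norm_sgn\<close>, erule (2) orth)
  have "\<exists>e. (e = 1 \<or> e = -1) \<and>
      (\<forall>U \<sigma> w. (U, \<sigma>) \<in> A \<longrightarrow> w \<in> U \<longrightarrow> sgn (horizontal_normal \<sigma> w) = e *\<^sub>R sgn (proj_xy n)) \<and>
      (\<forall>p\<in>{p. n \<bullet> p = d}. has_horizontal_mean_curvature A p (e *
         (frechet_derivative (\<lambda>_. sgn (proj_xy n)) (at p) (heis_X p) $ 1 +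
          frechet_derivative (\<lambda>_. sgn (proj_xy n)) (at p) (heis_Y p) $ 2)))"
    by (rule *(3)) (use n0 in \<open>simp add: norm_sgn\<close>, erule (2) orth)
  then show "\<forall>p\<in>{p. n \<bullet> p = d}. has_horizontal_mean_curvature A p 0"
    by simp blast
qed

lemma regular_surface_plane:
  assumes n: "n \<noteq> 0" "n$3 = 0"
  shows "\<exists>A. regular_surface A {p. n \<bullet> p = d}"
proof -
  \<comment> \<open>The vector \<open>n\<close> turned by a right angle. Together with the vertical
    axis it spans the directions of the plane, while \<open>(d / N) n\<close> is the point of the
    plane nearest to the origin. As \<open>e\<close> has squared length \<open>N\<close>, dividing
    by \<open>N\<close> in \<open>g\<close> recovers the coordinate along \<open>e\<close>.\<close>
  define e :: "real^3" where "e = vector [- n$2, n$1, 0]"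
  define N where "N = n \<bullet> n"
  have N: "N > 0" using n by (simp add: N_def)
  have N_eq: "N = n$1 * n$1 + n$2 * n$2" using n by (simp add: N_def inner_real3)
  define \<sigma> :: "real^2 \<Rightarrow> real^3" where "\<sigma> = (\<lambda>w. (d / N) *\<^sub>R n + w$1 *\<^sub>R e + w$2 *\<^sub>R axis 3 1)"
  define g :: "real^3 \<Rightarrow> real^2" where "g = (\<lambda>p. ((e \<bullet> p) / N) *\<^sub>R axis 1 1 + (p$3) *\<^sub>R axis 2 1)"
  have \<sigma>_nth: "\<sigma> w $ 1 = d / N * n$1 - w$1 * n$2" "\<sigma> w $ 2 = d / N * n$2 + w$1 * n$1" "\<sigma> w $ 3 = w$2" for w
    using n by (simp_all add: \<sigma>_def e_def)
  have g_nth: "g p $ 1 = (n$1 * p$2 - n$2 * p$1) / N" "g p $ 2 = p$3" for p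
    by (simp_all add: g_def e_def inner_real3)
  have smooth: "smooth_on UNIV \<sigma>"
  proof (rule smooth_on_real3)
    have "elementary_on UNIV (\<lambda>w. \<sigma> w $ 1)" "elementary_on UNIV (\<lambda>w. \<sigma> w $ 2)" "elementary_on UNIV (\<lambda>w. \<sigma> w $ 3)"
      unfolding \<sigma>_nth diff_conv_add_uminus mult_minus_right[symmetric]
      by (intro elementary_on.add elementary_on.mult elementary_on.const elementary_on.linear bounded_linear_vec_nth)+
    then show "smooth_on UNIV (\<lambda>w. \<sigma> w $ 1)" "smooth_on UNIV (\<lambda>w. \<sigma> w $ 2)" "smooth_on UNIV (\<lambda>w. \<sigma> w $ 3)"
      by (auto intro: elementary_on_imp_smooth_on)
  qed simp
  have g\<sigma>: "g (\<sigma> w) = w" for w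
    using N by (simp add: eq_real2_iff g_nth \<sigma>_nth field_simps) (simp add: N_eq field_simps)
  have "linear g" unfolding g_def
    by (rule linearI) (simp_all add: inner_add_right add_divide_distrib algebra_simps)
  then have g: "(g has_derivative g) (at p)" for p
    by (simp add: linear_conv_bounded_linear bounded_linear_imp_has_derivative)
  have "range \<sigma> = {p. n \<bullet> p = d}"
  proof (intro equalityI subsetI)
    fix p assume "p \<in> range \<sigma>"
    then obtain w where w: "p = \<sigma> w" by blast
    have "n \<bullet> \<sigma> w = d / N * N"
      unfolding inner_real3[of n "\<sigma> w"] \<sigma>_nth n(2) N_eq by (simp add: algebra_simps add_divide_distrib)
    then show "p \<in> {p. n \<bullet> p = d}" using N w by simp
  next
    fix p assume "p \<in> {p. n \<bullet> p = d}"
    then have d: "d = n$1 * p$1 + n$2 * p$2" using n by (simp add: inner_real3)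
    have "N * \<sigma> (g p) $ 1 = N * p$1" "N * \<sigma> (g p) $ 2 = N * p$2" "\<sigma> (g p) $ 3 = p$3"
      using N by (simp_all add: \<sigma>_nth g_nth d field_simps) (simp_all add: N_eq algebra_simps)
    then have "\<sigma> (g p) = p" using N by (simp add: eq_real3_iff)
    then show "p \<in> range \<sigma>" by (metis rangeI)
  qed
  from regular_surface_single_patch[OF open_UNIV smooth this g g\<sigma>] show ?thesis by blast
qed

section \<open>Right circular cylinders\<close>

definition radial_normal :: "real^2 \<Rightarrow> real^3 \<Rightarrow> real^2" where
  "radial_normal z p = sgn (proj_xy p - z)"

lemma radial_normal_nth:
  "radial_normal z p $ i = (proj_xy p - z) $ i * inverse (sqrt ((p$1 - z$1) * (p$1 - z$1) + (p$2 - z$2) * (p$2 - z$2)))"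
  by (simp add: radial_normal_def sgn_div_norm norm_real2 divide_inverse mult.commute)

lemma open_off_axis: "open {p. proj_xy p \<noteq> z}"
  using bounded_linear.continuous_on[OF bounded_linear_proj_xy continuous_on_id]
  by (intro open_Collect_neq) (auto intro!: continuous_intros)

lemma smooth_on_radial_normal: "smooth_on {p. proj_xy p \<noteq> z} (radial_normal z)"
proof (rule smooth_on_real2[OF open_off_axis])
  have lin: "elementary_on {p. proj_xy p \<noteq> z} (\<lambda>p. p$i - c)" for i c
    unfolding diff_conv_add_uminus
    by (intro elementary_on.add elementary_on.const elementary_on.linear bounded_linear_vec_nth)
  have "elementary_on {p. proj_xy p \<noteq> z} (\<lambda>p. (p$j - c) *
     inverse (sqrt ((p$1 - z$1) * (p$1 - z$1) + (p$2 - z$2) * (p$2 - z$2))))" for j c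
    by (intro elementary_on.mult elementary_on.inverse elementary_on.sqrt elementary_on.add lin)
      (auto simp: eq_real2_iff sum_squares_gt_zero_iff)
  then show "smooth_on {p. proj_xy p \<noteq> z} (\<lambda>p. radial_normal z p $ 1)"
    "smooth_on {p. proj_xy p \<noteq> z} (\<lambda>p. radial_normal z p $ 2)"
    unfolding radial_normal_nth by (simp_all add: elementary_on_imp_smooth_on open_off_axis)
qed

text \<open>\<open>radial_normal z\<close> is the outward unit normal of all cylinders around the
  axis at once and does not depend on the height, so X and Y act on it like the planar partial
  derivatives. The divergence of \<open>x / \<bar>x\<bar>\<close> in the plane is
  \<open>2 / R - R^2 / R^3\<close>.\<close>

lemma divergence_radial_normal:
  assumes "R > 0" "p \<in> right_cylinder z R"
  shows "frechet_derivative (radial_normal z) (at p) (heis_X p) $ 1 +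
         frechet_derivative (radial_normal z) (at p) (heis_Y p) $ 2 = 1 / R"
proof -
  define a b where "a = p$1 - z$1" and "b = p$2 - z$2"
  have R: "sqrt (a * a + b * b) = R"
    using assms(2) by (simp add: right_cylinder_iff norm_real2 a_def b_def)
  have R2: "a * a + b * b = R * R"
    using R assms(1) by (metis real_sqrt_eq_iff real_sqrt_mult_self real_sqrt_abs2 abs_of_pos)
  have off: "proj_xy p \<noteq> z" using assms by (auto simp: right_cylinder_iff)
  define q where "q = (\<lambda>p::real^3. (p$1 - z$1) * (p$1 - z$1) + (p$2 - z$2) * (p$2 - z$2))"
  have qp: "q p = R * R" using R2 by (simp add: q_def a_def b_def)
  have nth: "((\<lambda>x. x$i) has_derivative (\<lambda>h. h$i)) (at p)" for i
    by (rule bounded_linear_imp_has_derivative[OF bounded_linear_vec_nth])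
  have dq: "(q has_derivative (\<lambda>h. 2 * (a * h$1 + b * h$2))) (at p)"
    unfolding q_def a_def b_def
    by (rule has_derivative_eq_rhs, (rule derivative_intros nth)+) (simp add: algebra_simps)
  have dr: "((\<lambda>p. sqrt (q p)) has_derivative (\<lambda>h. (a * h$1 + b * h$2) / R)) (at p)"
    by (rule has_derivative_eq_rhs[OF has_derivative_real_sqrt[OF _ dq]])
      (use assms(1) in \<open>simp_all add: qp fun_eq_iff field_simps\<close>)
  have "((\<lambda>p. inverse (sqrt (q p))) has_derivative
     (\<lambda>h. - (inverse (sqrt (q p)) * ((a * h$1 + b * h$2) / R) * inverse (sqrt (q p))))) (at p)"
    by (rule Deriv.has_derivative_inverse[OF _ dr]) (use assms(1) in \<open>simp add: qp\<close>)
  from has_derivative_mult[OF has_derivative_diff[OF nth has_derivative_const] this]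
  have "((\<lambda>p. (p$i - c) * inverse (sqrt (q p))) has_derivative
     (\<lambda>h. h$i / R - (p$i - c) * (a * h$1 + b * h$2) / R^3)) (at p)" for i c
    by (rule has_derivative_eq_rhs) (use assms(1) in \<open>simp add: qp fun_eq_iff field_simps power3_eq_cube\<close>)
  note d = this[THEN frechet_derivativeI]
  have diff: "radial_normal z differentiable (at p)"
    using off by (intro smooth_on_imp_differentiable[OF smooth_on_radial_normal]) simp
  have D1: "frechet_derivative (radial_normal z) (at p) h $ 1 = h$1 / R - a * (a * h$1 + b * h$2) / R^3" for h
    using frechet_derivative_vec_nth(2)[OF diff, of 1] d[of 1 "z$1"]
    by (simp add: radial_normal_nth a_def q_def fun_eq_iff)
  have D2: "frechet_derivative (radial_normal z) (at p) h $ 2 = h$2 / R - b * (a * h$1 + b * h$2) / R^3" for h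
    using frechet_derivative_vec_nth(2)[OF diff, of 2] d[of 2 "z$2"]
    by (simp add: radial_normal_nth b_def q_def fun_eq_iff)
  have "frechet_derivative (radial_normal z) (at p) (heis_X p) $ 1 +
         frechet_derivative (radial_normal z) (at p) (heis_Y p) $ 2 = 2 / R - (a * a + b * b) / R^3"
    unfolding D1 D2 by (simp add: heis_X_def heis_Y_def add_divide_distrib)
  also have "\<dots> = 1 / R"
    unfolding R2 using assms(1) by (simp add: field_simps power3_eq_cube)
  finally show ?thesis .
qed

text \<open>The sign \<open>e\<close> is kept together with its meaning for the normal, so that for
  a concrete atlas it can be determined by evaluating the normal at one point.\<close>

lemma cylinder_surface:
  assumes R: "R > 0" and S: "regular_surface A (right_cylinder z R)"
  shows "characteristic_locus A = {}" "closed_induced_form A"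
    and "\<exists>e. (e = 1 \<or> e = -1) \<and>
      (\<forall>U \<sigma> w. (U, \<sigma>) \<in> A \<longrightarrow> w \<in> U \<longrightarrow> sgn (horizontal_normal \<sigma> w) = e *\<^sub>R radial_normal z (\<sigma> w)) \<and>
      (\<forall>p\<in>right_cylinder z R. has_horizontal_mean_curvature A p (e * (1 / R)))"
proof -
  have orth: "radial_normal z (\<sigma> w) \<bullet> proj_xy (frechet_derivative \<sigma> (at w) a) = 0"
    if p: "surface_patch U \<sigma>" "\<sigma> ` U \<subseteq> right_cylinder z R" "w \<in> U" for U \<sigma> w a
  proof -
    note q = surface_patchD(1,5)[OF p(1)]
    have d: "((\<lambda>x. proj_xy (\<sigma> x) - z) has_derivative (\<lambda>h. proj_xy (frechet_derivative \<sigma> (at w) h))) (at w)"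
      using has_derivative_diff[OF bounded_linear.has_derivative[OF bounded_linear_proj_xy
          has_derivative_frechet_derivative[OF q(2)[OF p(3)]]] has_derivative_const[of z]] by simp
    note has_derivative_inner[OF d d]
    moreover have "((\<lambda>x. (proj_xy (\<sigma> x) - z) \<bullet> (proj_xy (\<sigma> x) - z)) has_derivative (\<lambda>h. 0)) (at w)"
      by (rule has_derivative_transform_within_open[OF has_derivative_const[of "R\<^sup>2"] q(1) p(3)])
        (use p(2) in \<open>auto simp: right_cylinder_iff power2_norm_eq_inner[symmetric]\<close>)
    ultimately have "(proj_xy (\<sigma> w) - z) \<bullet> proj_xy (frechet_derivative \<sigma> (at w) a) +
      proj_xy (frechet_derivative \<sigma> (at w) a) \<bullet> (proj_xy (\<sigma> w) - z) = 0"
      by (rule has_derivative_unique[THEN fun_cong])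
    then show ?thesis by (simp add: radial_normal_def sgn_div_norm inner_commute)
  qed
  have sub: "right_cylinder z R \<subseteq> {p. proj_xy p \<noteq> z}"
    using R by (auto simp: right_cylinder_iff)
  have unit: "norm (radial_normal z q) = 1" if "q \<in> {p. proj_xy p \<noteq> z}" for q
    using that by (simp add: radial_normal_def norm_sgn)
  note * = vertical_surface[OF S connected_right_cylinder open_off_axis sub smooth_on_radial_normal]
  show "characteristic_locus A = {}"
    by (rule *(1)) (erule unit, erule (2) orth)
  show "closed_induced_form A"
    by (rule *(2)) (erule unit, erule (2) orth)
  have "\<exists>e. (e = 1 \<or> e = -1) \<and>
      (\<forall>U \<sigma> w. (U, \<sigma>) \<in> A \<longrightarrow> w \<in> U \<longrightarrow> sgn (horizontal_normal \<sigma> w) = e *\<^sub>R radial_normal z (\<sigma> w)) \<and>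
      (\<forall>p\<in>right_cylinder z R. has_horizontal_mean_curvature A p (e *
         (frechet_derivative (radial_normal z) (at p) (heis_X p) $ 1 +
          frechet_derivative (radial_normal z) (at p) (heis_Y p) $ 2)))"
    by (rule *(3)) (erule unit, erule (2) orth)
  then show "\<exists>e. (e = 1 \<or> e = -1) \<and>
      (\<forall>U \<sigma> w. (U, \<sigma>) \<in> A \<longrightarrow> w \<in> U \<longrightarrow> sgn (horizontal_normal \<sigma> w) = e *\<^sub>R radial_normal z (\<sigma> w)) \<and>
      (\<forall>p\<in>right_cylinder z R. has_horizontal_mean_curvature A p (e * (1 / R)))"
    by (simp only: divergence_radial_normal[OF R] cong: ball_cong)
qed

lemma regular_surface_cylinder:
  assumes R: "R > 0"
  shows "\<exists>A. regular_surface A (right_cylinder z R) \<and>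
    (\<forall>p\<in>right_cylinder z R. has_horizontal_mean_curvature A p (1 / R))"
proof -
  \<comment> \<open>One patch suffices, on the punctured plane; the sign of the logarithm makes the normal point outwards.\<close>
  let ?U = "- {0} :: (real^2) set"
  define r :: "real^2 \<Rightarrow> real" where "r = (\<lambda>w. sqrt (w$1 * w$1 + w$2 * w$2))"
  define \<sigma> :: "real^2 \<Rightarrow> real^3" where
    "\<sigma> = (\<lambda>w. vector [z$1 + R * w$1 * inverse (r w), z$2 + R * w$2 * inverse (r w), - 1 * ln (r w)])"
  \<comment> \<open>The patch sends the direction of \<open>w\<close> to the circle and stores its
    length in the height \<open>- ln (r w)\<close>; thus \<open>exp (- p$3)\<close> restores the
    length, and dividing by \<open>R\<close> normalises the radial vector.\<close>
  define g :: "real^3 \<Rightarrow> real^2" where "g = (\<lambda>p. (exp (- p$3) / R) *\<^sub>R (proj_xy p - z))"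
  have r: "r w = norm w" for w by (simp add: r_def norm_real2)
  have r_pos: "r w > 0" "w$1 * w$1 + w$2 * w$2 > 0" if "w \<in> ?U" for w
    using that by (auto simp: r eq_real2_iff sum_squares_gt_zero_iff)
  have el_r: "elementary_on ?U r"
    unfolding r_def using r_pos(2)
    by (intro elementary_on.sqrt elementary_on.add elementary_on.mult elementary_on.linear bounded_linear_vec_nth) auto
  have open_U: "open ?U" by (simp add: open_Compl)
  have smooth: "smooth_on ?U \<sigma>"
  proof (rule smooth_on_real3[OF open_U])
    have "elementary_on ?U (\<lambda>w. c + R * w$i * inverse (r w))" for c i
      using r_pos(1)
      by (intro elementary_on.inverse elementary_on.add elementary_on.mult elementary_on.linear el_r
          elementary_on.const bounded_linear_vec_nth) (auto simp: less_imp_neq[symmetric])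
    then show "smooth_on ?U (\<lambda>w. \<sigma> w $ 1)" "smooth_on ?U (\<lambda>w. \<sigma> w $ 2)"
      by (simp_all add: \<sigma>_def elementary_on_imp_smooth_on open_U)
    have "elementary_on ?U (\<lambda>w. - 1 * ln (r w))"
      using r_pos(1) by (intro elementary_on.mult elementary_on.const elementary_on.ln el_r) auto
    then show "smooth_on ?U (\<lambda>w. \<sigma> w $ 3)"
      unfolding \<sigma>_def vector_3 by (rule elementary_on_imp_smooth_on[OF open_U])
  qed
  have proj_\<sigma>: "proj_xy (\<sigma> w) - z = (R * inverse (r w)) *\<^sub>R w" for w
    by (simp add: eq_real2_iff \<sigma>_def)
  have g\<sigma>: "g (\<sigma> w) = w" if "w \<in> ?U" for w
    using r_pos(1)[OF that] R by (simp add: g_def proj_\<sigma>) (simp add: \<sigma>_def)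
  have "\<exists>g'. (g has_derivative g') (at p)" for p
    unfolding g_def divide_inverse
    by (rule exI, (rule derivative_intros bounded_linear_imp_has_derivative[OF bounded_linear_vec_nth]
        bounded_linear_imp_has_derivative[OF bounded_linear_proj_xy])+)
  then obtain g' where g': "(g has_derivative g' p) (at p)" for p by metis
  have "\<sigma> ` ?U = right_cylinder z R"
  proof (intro equalityI subsetI)
    fix p assume "p \<in> \<sigma> ` ?U"
    then obtain w where w: "w \<in> ?U" "p = \<sigma> w" by blast
    then show "p \<in> right_cylinder z R"
      using r_pos(1)[OF w(1)] R by (simp add: right_cylinder_iff proj_\<sigma> abs_mult) (simp add: r)
  next
    fix p assume p: "p \<in> right_cylinder z R"
    then have n: "norm (proj_xy p - z) = R" by (simp add: right_cylinder_iff)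
    have rg: "r (g p) = exp (- p$3)" using R by (simp add: r g_def n)
    have "proj_xy (\<sigma> (g p)) - z = proj_xy p - z"
      unfolding proj_\<sigma> rg using R by (simp add: g_def)
    then have "\<sigma> (g p) = p" by (simp add: eq_real3_iff eq_real2_iff) (simp add: \<sigma>_def rg)
    moreover have "g p \<in> ?U" using rg r by (metis Compl_iff exp_not_eq_zero norm_zero singletonD)
    ultimately show "p \<in> \<sigma> ` ?U" by (metis imageI)
  qed
  from regular_surface_single_patch[OF open_U smooth this g' g\<sigma>]
  have S: "regular_surface {(?U, \<sigma>)} (right_cylinder z R)" .
  from cylinder_surface(3)[OF R S] obtain e :: real where e: "e = 1 \<or> e = -1"
    "\<forall>U \<tau> w. (U, \<tau>) \<in> {(?U, \<sigma>)} \<longrightarrow> w \<in> U \<longrightarrow> sgn (horizontal_normal \<tau> w) = e *\<^sub>R radial_normal z (\<tau> w)"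
    "\<forall>p\<in>right_cylinder z R. has_horizontal_mean_curvature {(?U, \<sigma>)} p (e * (1 / R))"
    by (elim exE conjE) (rule that)
  \<comment> \<open>The sign \<open>e\<close> is global, so this one parameter decides it. Here
    \<open>r\<close> equals 1, the outward direction has first component 1, and the horizontal
    normal has first component \<open>R > 0\<close>.\<close>
  define w :: "real^2" where "w = axis 1 1"
  have w: "w \<in> ?U" "r w = 1" by (simp_all add: w_def r norm_axis_1)
  have diff: "\<sigma> differentiable at w" by (rule smooth_on_imp_differentiable[OF smooth w(1)])
  have dr: "(r has_derivative (\<lambda>h. h$1)) (at w)"
    unfolding r_def
    by (auto intro!: derivative_eq_intros bounded_linear_imp_has_derivative bounded_linear_vec_nth simp: w_def)
  have nth: "((\<lambda>x. x$i) has_derivative (\<lambda>h. h$i)) (at w)" for i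
    by (rule bounded_linear_imp_has_derivative[OF bounded_linear_vec_nth])
  have d2: "((\<lambda>x. \<sigma> x $ 2) has_derivative (\<lambda>h. R * h$2)) (at w)"
    unfolding \<sigma>_def vector_3
    by (rule has_derivative_eq_rhs, (rule derivative_intros nth dr | simp add: w)+) (simp add: w_def)
  have d3: "((\<lambda>x. \<sigma> x $ 3) has_derivative (\<lambda>h. - h$1)) (at w)"
    unfolding \<sigma>_def vector_3 using w(2)
    by (auto intro!: derivative_eq_intros dr)
  have D: "frechet_derivative \<sigma> (at w) h $ 2 = R * h$2" "frechet_derivative \<sigma> (at w) h $ 3 = - h$1" for h
    using frechet_derivative_vec_nth(2)[OF diff] frechet_derivativeI[OF d2] frechet_derivativeI[OF d3] by metis+
  have d1: "((\<lambda>x. \<sigma> x $ 1) has_derivative (\<lambda>h. 0)) (at w)"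
    unfolding \<sigma>_def vector_3
    by (rule has_derivative_eq_rhs, (rule derivative_intros nth dr | simp add: w)+) (simp add: w_def w(2)[unfolded w_def])
  have D1: "frechet_derivative \<sigma> (at w) h $ 1 = 0" for h
    using frechet_derivative_vec_nth(2)[OF diff] frechet_derivativeI[OF d1] by metis
  have N1: "horizontal_normal \<sigma> w $ 1 = R"
    unfolding horizontal_normal_nth[OF diff] D D1 by simp
  have "radial_normal z (\<sigma> w) $ 1 = 1"
    using R unfolding radial_normal_def proj_\<sigma> w(2) by (simp add: w_def sgn_div_norm norm_axis_1)
  then have "e = sgn (horizontal_normal \<sigma> w) $ 1" using e(2) w(1) by simp
  also have "\<dots> \<ge> 0" using R by (simp add: sgn_div_norm N1)
  finally have "e = 1" using e(1) by auto
  with e(3) S show ?thesis by auto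
qed

text \<open>Surfaces may be disconnected and may be proper open pieces of a model, hence the
  formulation by components with equality for closed ones. Reversing the orientation changes the
  sign of the curvature, hence both signs for a given cylinder and a separate claim that some
  orientation yields \<open>1 / R\<close>.\<close>

theorem proposition5p3:
  "(\<forall>A S c.
      regular_surface A S \<and> characteristic_locus A = {} \<and> closed_induced_form A \<and>
      (\<forall>p\<in>S. has_horizontal_mean_curvature A p c) \<longrightarrow>
      (\<forall>C\<in>components S.
         (c = 0 \<and>
          (\<exists>P. vertical_plane P \<and> openin (top_of_set P) C \<and> (closed C \<longrightarrow> C = P))) \<or>
         (\<exists>z R. R > 0 \<and> (c = 1 / R \<or> c = - (1 / R)) \<and>
          openin (top_of_set (right_cylinder z R)) C \<and>
          (closed C \<longrightarrow> C = right_cylinder z R))))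
   \<and>
   (\<forall>P. vertical_plane P \<longrightarrow>
      (\<exists>A. regular_surface A P) \<and>
      (\<forall>A. regular_surface A P \<longrightarrow>
         characteristic_locus A = {} \<and> closed_induced_form A \<and>
         (\<forall>p\<in>P. has_horizontal_mean_curvature A p 0)))
   \<and>
   (\<forall>z R. R > 0 \<longrightarrow>
      (\<exists>A. regular_surface A (right_cylinder z R) \<and>
         (\<forall>p\<in>right_cylinder z R. has_horizontal_mean_curvature A p (1 / R))) \<and>
      (\<forall>A. regular_surface A (right_cylinder z R) \<longrightarrow>
         characteristic_locus A = {} \<and> closed_induced_form A \<and>
         ((\<forall>p\<in>right_cylinder z R. has_horizontal_mean_curvature A p (1 / R)) \<or>
          (\<forall>p\<in>right_cylinder z R. has_horizontal_mean_curvature A p (- (1 / R))))))"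
proof (intro conjI allI impI ballI)
  fix A S c C
  assume "regular_surface A S \<and> characteristic_locus A = {} \<and> closed_induced_form A \<and>
      (\<forall>p\<in>S. has_horizontal_mean_curvature A p c)" "C \<in> components S"
  then show "(c = 0 \<and>
          (\<exists>P. vertical_plane P \<and> openin (top_of_set P) C \<and> (closed C \<longrightarrow> C = P))) \<or>
         (\<exists>z R. R > 0 \<and> (c = 1 / R \<or> c = - (1 / R)) \<and>
          openin (top_of_set (right_cylinder z R)) C \<and>
          (closed C \<longrightarrow> C = right_cylinder z R))"
    by (elim conjE) (rule component_of_constant_curvature_surface)
next
  fix P assume "vertical_plane P"
  then show "\<exists>A. regular_surface A P"
    unfolding vertical_plane_def using regular_surface_plane by blast
next
  fix P A assume "vertical_plane P" and A: "regular_surface A P"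
  then obtain n d where n: "n \<noteq> 0" "n$3 = 0" and P: "P = {p. n \<bullet> p = d}"
    unfolding vertical_plane_def by blast
  note * = plane_surface[OF n A[unfolded P], folded P]
  show "characteristic_locus A = {}" "closed_induced_form A" by (fact *(1,2))+
  show "has_horizontal_mean_curvature A p 0" if "p \<in> P" for p using *(3) that by blast
next
  fix z R assume R: "R > (0::real)"
  show "\<exists>A. regular_surface A (right_cylinder z R) \<and>
         (\<forall>p\<in>right_cylinder z R. has_horizontal_mean_curvature A p (1 / R))"
    by (rule regular_surface_cylinder[OF R])
next
  fix z R A assume R: "R > (0::real)" and A: "regular_surface A (right_cylinder z R)"
  show "characteristic_locus A = {}" "closed_induced_form A" by (fact cylinder_surface(1,2)[OF R A])+
  from cylinder_surface(3)[OF R A]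
  show "(\<forall>p\<in>right_cylinder z R. has_horizontal_mean_curvature A p (1 / R)) \<or>
          (\<forall>p\<in>right_cylinder z R. has_horizontal_mean_curvature A p (- (1 / R)))"
    by (elim exE conjE disjE) auto
qed

end
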